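(* Let $p\ge 2$ be an integer, $x\in\operatorname{dom} h$, $\beta>1$ and $H=\beta L_p$. Let $T$ be a minimizer of $$y\mapsto \Omega_p(f,x;y)+\frac{H}{(p+1)!}\|y-x\|^{p+1}+h(y)$$ over $y\in\mathbb{E}$, and let $$F'(T)=\nabla f(T)-\nabla\Omega_p(f,x;T)-\frac{H}{p!}\|T-x\|^{p-1}B(T-x)\in\mathbb{E}^*.$$ Then $$\langle F'(T),x-T\rangle\;\ge\;\Big(\frac{p!}{(p+1)L_p}\Big)^{1/p}\,\|F'(T)\|_*^{\frac{p+1}{p}}\cdot\frac{(\beta^2-1)^{\frac{p-1}{2p}}}{\beta}\cdot\frac{p}{(p^2-1)^{\frac{p-1}{2p}}}.$$ In particular, if $\beta=p$, then $\langle F'(T),x-T\rangle\ge \big(\frac{p!}{(p+1)L_p}\big)^{1/p}\|F'(T)\|_*^{(p+1)/p}$.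
   Context: $\mathbb{E}$ is a finite-dimensional real vector space with dual $\mathbb{E}^*$ and pairing $\langle s,x\rangle$. Fix a self-adjoint positive-definite linear operator $B:\mathbb{E}\to\mathbb{E}^*$ and set $\|x\|=\langle Bx,x\rangle^{1/2}$ for $x\in\mathbb{E}$, $\|g\|_*=\langle g,B^{-1}g\rangle^{1/2}$ for $g\in\mathbb{E}^*$. For a $p$ times differentiable function $f$, $D^kf(x)[h]^k$ is the $k$-th directional derivative along $h$, and for symmetric $p$-linear forms $\|A\|=\max_{\|h\|\le 1}|A[h]^p|$. Let $h:\mathbb{E}\to\mathbb{R}\cup\{+\infty\}$ be a proper closed convex function and $f$ a convex function, $p$ times differentiable on an open convex set containing $\operatorname{dom} h$, with $\|D^pf(x)-D^pf(y)\|\le L_p\|x-y\|$ for all $x,y\in\operatorname{dom}h$, where $0<L_p<\infty$. Let $F=f+h$. The Taylor polynomial is $\Omega_p(f,x;y)=f(x)+\sum_{k=1}^p\frac1{k!}D^kf(x)[y-x]^k$, and its gradient in $y$ is $\nabla\Omega_p(f,x;y)=\sum_{k=1}^p\frac{1}{(k-1)!}D^kf(x)[y-x]^{k-1}\in\mathbb{E}^*$. *)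

theory Defs
  imports "HOL-Analysis.Analysis"
begin

text \<open>The space E is modelled as a Euclidean space 'a; its dual E* is identified with 'a
  through the inner product, so the pairing <s,x> is  inner s x.
  B : E -> E* is then a linear map 'a => 'a, self-adjoint and positive definite.\<close>

definition self_adjoint_pd :: "('a::euclidean_space \<Rightarrow> 'a) \<Rightarrow> bool" where
  "self_adjoint_pd B \<longleftrightarrow> linear B \<and> (\<forall>x y. inner (B x) y = inner x (B y))
      \<and> (\<forall>x. x \<noteq> 0 \<longrightarrow> inner (B x) x > 0)"

definition Bnorm :: "('a::euclidean_space \<Rightarrow> 'a) \<Rightarrow> 'a \<Rightarrow> real" where
  "Bnorm B x = sqrt (inner (B x) x)"

definition Bdnorm :: "('a::euclidean_space \<Rightarrow> 'a) \<Rightarrow> 'a \<Rightarrow> real" where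
  "Bdnorm B g = sqrt (inner g (inv B g))"

text \<open>Riesz representative in E (= E*) of a linear functional.\<close>
definition dual_vec :: "('a::euclidean_space \<Rightarrow> real) \<Rightarrow> 'a" where
  "dual_vec \<phi> = (\<Sum>b\<in>Basis. \<phi> b *\<^sub>R b)"

text \<open>Norm of a p-linear form A (given as a function of a list of p arguments):
  max over B-unit vectors of |A[v]^p|.\<close>
definition form_norm :: "('a::euclidean_space \<Rightarrow> 'a) \<Rightarrow> nat \<Rightarrow> ('a list \<Rightarrow> real) \<Rightarrow> real" where
  "form_norm B p A = (SUP v\<in>{v. Bnorm B v \<le> 1}. \<bar>A (replicate p v)\<bar>)"

text \<open>D k x hs = D^k f(x)[hs_1,...,hs_k]; D is the family of Frechet derivatives of f
  up to order p on the open set U.\<close>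
definition derivs_upto :: "nat \<Rightarrow> ('a::euclidean_space \<Rightarrow> real) \<Rightarrow> (nat \<Rightarrow> 'a \<Rightarrow> 'a list \<Rightarrow> real)
    \<Rightarrow> 'a set \<Rightarrow> bool" where
  "derivs_upto p f D U \<longleftrightarrow> (\<forall>x\<in>U. D 0 x [] = f x) \<and>
     (\<forall>k<p. \<forall>x\<in>U. \<forall>hs. length hs = k \<longrightarrow>
        ((\<lambda>z. D k z hs) has_derivative (\<lambda>v. D (Suc k) x (v # hs))) (at x))"

definition taylor :: "nat \<Rightarrow> ('a::euclidean_space \<Rightarrow> real) \<Rightarrow> (nat \<Rightarrow> 'a \<Rightarrow> 'a list \<Rightarrow> real)
    \<Rightarrow> 'a \<Rightarrow> 'a \<Rightarrow> real" where
  "taylor p f D x y = f x + (\<Sum>k=1..p. D k x (replicate k (y - x)) / fact k)"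

definition taylor_grad :: "nat \<Rightarrow> (nat \<Rightarrow> 'a::euclidean_space \<Rightarrow> 'a list \<Rightarrow> real)
    \<Rightarrow> 'a \<Rightarrow> 'a \<Rightarrow> 'a" where
  "taylor_grad p D x y = dual_vec (\<lambda>u. \<Sum>k=1..p. D k x (u # replicate (k - 1) (y - x)) / fact (k - 1))"

text \<open>Extended-valued functions h : E -> R \<union> {+\<infinity>} as ereal-valued functions.\<close>
definition edom :: "('a \<Rightarrow> ereal) \<Rightarrow> 'a set" where
  "edom h = {x. h x < \<infinity>}"

definition proper_fun :: "('a \<Rightarrow> ereal) \<Rightarrow> bool" where
  "proper_fun h \<longleftrightarrow> (\<exists>x. h x < \<infinity>) \<and> (\<forall>x. h x > -\<infinity>)"

definition closed_fun :: "('a::topological_space \<Rightarrow> ereal) \<Rightarrow> bool" where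
  "closed_fun h \<longleftrightarrow> closed {(x, t::real). h x \<le> ereal t}"

definition convex_fun :: "('a::real_vector \<Rightarrow> ereal) \<Rightarrow> bool" where
  "convex_fun h \<longleftrightarrow> (\<forall>x y t. 0 \<le> t \<and> t \<le> 1 \<longrightarrow>
      h ((1 - t) *\<^sub>R x + t *\<^sub>R y) \<le> ereal (1 - t) * h x + ereal t * h y)"

end

(*
  Write r = T - x, let g be the difference of the gradients of f and of its Taylor
  polynomial at T, and c = H |r|^(p-1) / p!, so that F'(T) = g - c B r.  Taylor's theorem
  along the segment [x, T] and the Lipschitz continuity of D^p f bound |g|_* by
  K = L_p |r|^p / p!.  This needs the value of the symmetric form D^p f(y) - D^p f(x) at
  [u, r, ..., r], which is controlled by its values on the diagonal by Banach's theorem: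
  for a symmetric multilinear form the supremum over independent unit vectors equals the
  supremum over equal ones.  Expanding |F'(T) + c B r|_*^2 <= K^2 gives
  2 c <F'(T), x - T> >= |F'(T)|_*^2 + (beta^2 - 1) K^2, and Young's inequality with the
  weights (p+1)/(2p) and (p-1)/(2p) eliminates |r| from the right-hand side.
*)
theory Submission
  imports Defs "HOL-Library.Multiset"
begin

lemma linear_functional_Basis_expansion:
  fixes \<phi> :: "'a::euclidean_space \<Rightarrow> real"
  assumes "linear \<phi>"
  shows "\<phi> v = (\<Sum>b\<in>Basis. (v \<bullet> b) * \<phi> b)"
  using Linear_Algebra.linear_componentwise[OF assms, of v 1] by simp

lemma dual_vec_inner:
  fixes \<phi> :: "'a::euclidean_space \<Rightarrow> real"
  assumes "linear \<phi>"
  shows "inner (dual_vec \<phi>) u = \<phi> u"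
  using linear_functional_Basis_expansion[OF assms, of u]
  by (simp add: dual_vec_def inner_sum_right inner_commute mult.commute)

section \<open>Symmetry of higher derivatives\<close>

lemma has_real_derivative_along_line:
  fixes g :: "'a::real_normed_vector \<Rightarrow> real"
  assumes "(g has_derivative G) (at (y + s *\<^sub>R a))"
  shows "((\<lambda>s. g (y + s *\<^sub>R a)) has_real_derivative G a) (at s)"
proof -
  have "((\<lambda>s. y + s *\<^sub>R a) has_derivative (\<lambda>h. h *\<^sub>R a)) (at s)"
    by (auto intro!: derivative_eq_intros)
  from has_derivative_compose[OF this assms]
  have "((\<lambda>s. g (y + s *\<^sub>R a)) has_derivative (\<lambda>h. G (h *\<^sub>R a))) (at s)" .
  moreover have "(\<lambda>h. G (h *\<^sub>R a)) = (*) (G a)"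
    using has_derivative_linear[OF assms] by (auto simp: linear_cmul fun_eq_iff)
  ultimately show ?thesis by (simp add: has_field_derivative_def)
qed

lemma second_difference_mean_value:
  fixes g :: "'a::real_normed_vector \<Rightarrow> real"
  assumes t: "0 < t"
    and dg: "\<And>z. z \<in> U \<Longrightarrow> (g has_derivative G z) (at z)"
    and seg: "\<And>s. 0 \<le> s \<Longrightarrow> s \<le> t \<Longrightarrow> y + s *\<^sub>R a \<in> U \<and> (y + t *\<^sub>R b) + s *\<^sub>R a \<in> U"
  obtains \<xi> where "0 < \<xi>" "\<xi> < t"
    "g (y + t *\<^sub>R a + t *\<^sub>R b) - g (y + t *\<^sub>R a) - g (y + t *\<^sub>R b) + g y
       = t * (G ((y + t *\<^sub>R b) + \<xi> *\<^sub>R a) a - G (y + \<xi> *\<^sub>R a) a)"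
proof -
  define \<psi> where "\<psi> s = g ((y + t *\<^sub>R b) + s *\<^sub>R a) - g (y + s *\<^sub>R a)" for s
  have "DERIV \<psi> s :> G ((y + t *\<^sub>R b) + s *\<^sub>R a) a - G (y + s *\<^sub>R a) a"
    if "0 \<le> s" "s \<le> t" for s
  proof -
    have "((\<lambda>s. g ((y + t *\<^sub>R b) + s *\<^sub>R a)) has_real_derivative G ((y + t *\<^sub>R b) + s *\<^sub>R a) a) (at s)"
      "((\<lambda>s. g (y + s *\<^sub>R a)) has_real_derivative G (y + s *\<^sub>R a) a) (at s)"
      using seg[OF that] by (auto intro: has_real_derivative_along_line dg)
    then show ?thesis
      unfolding \<psi>_def by (rule DERIV_diff)
  qed
  from MVT2[OF t, of \<psi> "\<lambda>s. G ((y + t *\<^sub>R b) + s *\<^sub>R a) a - G (y + s *\<^sub>R a) a", OF this]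
  obtain \<xi> where "0 < \<xi>" "\<xi> < t"
    and "\<psi> t - \<psi> 0 = (t - 0) * (G ((y + t *\<^sub>R b) + \<xi> *\<^sub>R a) a - G (y + \<xi> *\<^sub>R a) a)"
    by blast
  moreover have "\<psi> t - \<psi> 0 = g (y + t *\<^sub>R a + t *\<^sub>R b) - g (y + t *\<^sub>R a) - g (y + t *\<^sub>R b) + g y"
    unfolding \<psi>_def by (simp add: algebra_simps)
  ultimately show ?thesis using that by simp
qed

lemma derivative_increment_estimate:
  fixes G :: "'a::real_normed_vector \<Rightarrow> 'a \<Rightarrow> real"
  assumes lin_H: "linear (\<lambda>w. H w a)"
    and G_approx: "\<And>z. norm (z - y) < d \<Longrightarrow> norm (G z a - G y a - H (z - y) a) \<le> e * norm (z - y)"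
    and e: "0 \<le> e" and \<xi>: "0 \<le> \<xi>" "\<xi> \<le> t" and td: "t * (norm a + norm b) < d"
  shows "\<bar>G ((y + t *\<^sub>R b) + \<xi> *\<^sub>R a) a - G (y + \<xi> *\<^sub>R a) a - t * H b a\<bar>
    \<le> e * t * (2 * norm a + norm b)"
proof -
  define X where "X = norm a + norm b"
  have "norm (\<xi> *\<^sub>R a + t *\<^sub>R b) \<le> \<xi> * norm a + t * norm b"
    using norm_triangle_ineq[of "\<xi> *\<^sub>R a" "t *\<^sub>R b"] \<xi> by simp
  also have "\<dots> \<le> t * X" unfolding X_def using \<xi> by (simp add: distrib_left mult_right_mono)
  finally have n1: "norm (\<xi> *\<^sub>R a + t *\<^sub>R b) \<le> t * X" .
  have n2: "norm (\<xi> *\<^sub>R a) \<le> t * norm a" using \<xi> by (simp add: mult_right_mono)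
  also have "\<dots> \<le> t * X" unfolding X_def using \<xi> by (simp add: mult_left_mono)
  finally have n2': "norm (\<xi> *\<^sub>R a) < d" using td unfolding X_def by simp
  have "\<bar>G ((y + t *\<^sub>R b) + \<xi> *\<^sub>R a) a - G y a - H (\<xi> *\<^sub>R a + t *\<^sub>R b) a\<bar>
      \<le> e * norm (\<xi> *\<^sub>R a + t *\<^sub>R b)"
    using G_approx[of "(y + t *\<^sub>R b) + \<xi> *\<^sub>R a"] n1 td unfolding X_def by (simp add: algebra_simps)
  also have "\<dots> \<le> e * (t * X)" using n1 e by (simp add: mult_left_mono)
  finally have e1: "\<bar>G ((y + t *\<^sub>R b) + \<xi> *\<^sub>R a) a - G y a - H (\<xi> *\<^sub>R a + t *\<^sub>R b) a\<bar>
      \<le> e * (t * X)" .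
  have "\<bar>G (y + \<xi> *\<^sub>R a) a - G y a - H (\<xi> *\<^sub>R a) a\<bar> \<le> e * norm (\<xi> *\<^sub>R a)"
    using G_approx[of "y + \<xi> *\<^sub>R a"] n2' by simp
  also have "\<dots> \<le> e * (t * norm a)" using n2 e by (simp add: mult_left_mono)
  finally have e2: "\<bar>G (y + \<xi> *\<^sub>R a) a - G y a - H (\<xi> *\<^sub>R a) a\<bar> \<le> e * (t * norm a)" .
  have H_diff: "H (\<xi> *\<^sub>R a + t *\<^sub>R b) a - H (\<xi> *\<^sub>R a) a = t * H b a"
    using linear_add[OF lin_H] linear_cmul[OF lin_H] by simp
  have "G ((y + t *\<^sub>R b) + \<xi> *\<^sub>R a) a - G (y + \<xi> *\<^sub>R a) a - t * H b a
      = (G ((y + t *\<^sub>R b) + \<xi> *\<^sub>R a) a - G y a - H (\<xi> *\<^sub>R a + t *\<^sub>R b) a)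
        - (G (y + \<xi> *\<^sub>R a) a - G y a - H (\<xi> *\<^sub>R a) a)"
    using H_diff by linarith
  then have "\<bar>G ((y + t *\<^sub>R b) + \<xi> *\<^sub>R a) a - G (y + \<xi> *\<^sub>R a) a - t * H b a\<bar>
      \<le> \<bar>G ((y + t *\<^sub>R b) + \<xi> *\<^sub>R a) a - G y a - H (\<xi> *\<^sub>R a + t *\<^sub>R b) a\<bar>
        + \<bar>G (y + \<xi> *\<^sub>R a) a - G y a - H (\<xi> *\<^sub>R a) a\<bar>"
    by (simp only: abs_triangle_ineq4)
  also have "\<dots> \<le> e * (t * X) + e * (t * norm a)"
    using e1 e2 by (rule add_mono)
  also have "\<dots> = e * t * (2 * norm a + norm b)"
    unfolding X_def by (simp add: algebra_simps)
  finally show ?thesis .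
qed

lemma second_difference_estimate:
  fixes g :: "'a::real_normed_vector \<Rightarrow> real"
  assumes U: "open U" "y \<in> U"
    and dg: "\<And>z. z \<in> U \<Longrightarrow> (g has_derivative G z) (at z)"
    and dG: "((\<lambda>z. G z a) has_derivative (\<lambda>w. H w a)) (at y)"
    and e: "e > 0"
  shows "\<exists>d>0. \<forall>t. 0 < t \<and> t < d \<longrightarrow>
     \<bar>g (y + t *\<^sub>R a + t *\<^sub>R b) - g (y + t *\<^sub>R a) - g (y + t *\<^sub>R b) + g y - t\<^sup>2 * H b a\<bar>
       \<le> e * t\<^sup>2 * (2 * norm a + norm b)"
proof -
  from dG[unfolded has_derivative_at_alt] e obtain d1 where d1: "d1 > 0"
    and G_approx: "\<And>z. norm (z - y) < d1 \<Longrightarrow> norm (G z a - G y a - H (z - y) a) \<le> e * norm (z - y)"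
    and lin_H: "linear (\<lambda>w. H w a)"
    using bounded_linear.linear by blast
  obtain d0 where d0: "d0 > 0" "ball y d0 \<subseteq> U"
    using U open_contains_ball by blast
  define X where "X = norm a + norm b"
  define d where "d = min d1 d0 / (X + 1)"
  have X: "X \<ge> 0" unfolding X_def by simp
  have d: "d > 0" unfolding d_def using d1 d0 X by auto
  show ?thesis
  proof (intro exI[of _ d] conjI allI impI d)
    fix t assume "0 < t \<and> t < d"
    then have t: "0 < t" "t < d" by auto
    have "t * X \<le> d * X" using t X by (simp add: mult_right_mono)
    also have "\<dots> < d * (X + 1)" using d by simp
    also have "\<dots> = min d1 d0" unfolding d_def using X by simp
    finally have tX: "t * X < min d1 d0" .
    have inU: "y + w \<in> U" if "norm w \<le> t * X" for w
      using d0(2) that tX by (auto simp: subset_iff dist_norm)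
    have "y + s *\<^sub>R a \<in> U \<and> (y + t *\<^sub>R b) + s *\<^sub>R a \<in> U" if "0 \<le> s" "s \<le> t" for s
    proof -
      have "norm (s *\<^sub>R a + t *\<^sub>R b) \<le> s * norm a + t * norm b"
        using norm_triangle_ineq[of "s *\<^sub>R a" "t *\<^sub>R b"] that by simp
      also have "\<dots> \<le> t * X" unfolding X_def using that by (simp add: distrib_left mult_right_mono)
      finally have "y + (s *\<^sub>R a + t *\<^sub>R b) \<in> U" by (rule inU)
      moreover have "s * norm a \<le> t * norm a" using that by (simp add: mult_right_mono)
      then have "y + s *\<^sub>R a \<in> U"
        using that t by (intro inU) (simp add: X_def distrib_left add_increasing2)
      ultimately show ?thesis by (simp add: algebra_simps)
    qed
    then obtain \<xi> where \<xi>: "0 < \<xi>" "\<xi> < t" and mv: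
      "g (y + t *\<^sub>R a + t *\<^sub>R b) - g (y + t *\<^sub>R a) - g (y + t *\<^sub>R b) + g y
         = t * (G ((y + t *\<^sub>R b) + \<xi> *\<^sub>R a) a - G (y + \<xi> *\<^sub>R a) a)"
      using second_difference_mean_value[OF t(1) dg] by blast
    have est: "\<bar>G ((y + t *\<^sub>R b) + \<xi> *\<^sub>R a) a - G (y + \<xi> *\<^sub>R a) a - t * H b a\<bar>
        \<le> e * t * (2 * norm a + norm b)"
      using derivative_increment_estimate[where G = G and H = H and a = a, OF lin_H G_approx] e \<xi> tX
      unfolding X_def by simp
    have "g (y + t *\<^sub>R a + t *\<^sub>R b) - g (y + t *\<^sub>R a) - g (y + t *\<^sub>R b) + g y - t\<^sup>2 * H b a
        = t * (G ((y + t *\<^sub>R b) + \<xi> *\<^sub>R a) a - G (y + \<xi> *\<^sub>R a) a - t * H b a)"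
      unfolding mv by (simp add: power2_eq_square algebra_simps)
    then have "\<bar>g (y + t *\<^sub>R a + t *\<^sub>R b) - g (y + t *\<^sub>R a) - g (y + t *\<^sub>R b) + g y - t\<^sup>2 * H b a\<bar>
        = t * \<bar>G ((y + t *\<^sub>R b) + \<xi> *\<^sub>R a) a - G (y + \<xi> *\<^sub>R a) a - t * H b a\<bar>"
      using t by (simp add: abs_mult)
    also have "\<dots> \<le> t * (e * t * (2 * norm a + norm b))"
      using est t by (simp add: mult_left_mono)
    finally show "\<bar>g (y + t *\<^sub>R a + t *\<^sub>R b) - g (y + t *\<^sub>R a) - g (y + t *\<^sub>R b) + g y - t\<^sup>2 * H b a\<bar>
       \<le> e * t\<^sup>2 * (2 * norm a + norm b)" by (simp add: power2_eq_square ac_simps)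
  qed
qed

lemma second_derivative_symmetric:
  fixes g :: "'a::real_normed_vector \<Rightarrow> real"
  assumes U: "open U" "y \<in> U"
    and dg: "\<And>z. z \<in> U \<Longrightarrow> (g has_derivative G z) (at z)"
    and dG: "\<And>v. ((\<lambda>z. G z v) has_derivative (\<lambda>w. H w v)) (at y)"
  shows "H a b = H b a"
proof (rule ccontr)
  assume ne: "H a b \<noteq> H b a"
  define K where "K = 3 * (norm a + norm b)"
  define e where "e = \<bar>H a b - H b a\<bar> / (K + 1)"
  have K: "K \<ge> 0" unfolding K_def by simp
  have e: "e > 0" unfolding e_def using ne K by auto
  define Q where "Q t = g (y + t *\<^sub>R a + t *\<^sub>R b) - g (y + t *\<^sub>R a) - g (y + t *\<^sub>R b) + g y" for t
  have Q_swap: "Q t = g (y + t *\<^sub>R b + t *\<^sub>R a) - g (y + t *\<^sub>R b) - g (y + t *\<^sub>R a) + g y" for t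
    unfolding Q_def by (simp add: algebra_simps)
  have "\<exists>d>0. \<forall>t. 0 < t \<and> t < d \<longrightarrow> \<bar>Q t - t\<^sup>2 * H b a\<bar> \<le> e * t\<^sup>2 * (2 * norm a + norm b)"
    unfolding Q_def
    by (rule second_difference_estimate[where g = g and G = G and H = H and a = a and b = b, OF U dg dG e])
  then obtain da where da: "da > 0"
    and Qa: "\<forall>t. 0 < t \<and> t < da \<longrightarrow> \<bar>Q t - t\<^sup>2 * H b a\<bar> \<le> e * t\<^sup>2 * (2 * norm a + norm b)"
    by blast
  have "\<exists>d>0. \<forall>t. 0 < t \<and> t < d \<longrightarrow> \<bar>Q t - t\<^sup>2 * H a b\<bar> \<le> e * t\<^sup>2 * (2 * norm b + norm a)"
    unfolding Q_swap
    by (rule second_difference_estimate[where g = g and G = G and H = H and a = b and b = a, OF U dg dG e])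
  then obtain db where db: "db > 0"
    and Qb: "\<forall>t. 0 < t \<and> t < db \<longrightarrow> \<bar>Q t - t\<^sup>2 * H a b\<bar> \<le> e * t\<^sup>2 * (2 * norm b + norm a)"
    by blast
  define t where "t = min da db / 2"
  have t: "t > 0" "t < da" "t < db" unfolding t_def using da db by auto
  have "t\<^sup>2 * \<bar>H a b - H b a\<bar> = \<bar>t\<^sup>2 * (H a b - H b a)\<bar>"
    by (simp add: abs_mult)
  also have "\<dots> = \<bar>(Q t - t\<^sup>2 * H b a) - (Q t - t\<^sup>2 * H a b)\<bar>"
    by (simp add: algebra_simps)
  also have "\<dots> \<le> \<bar>Q t - t\<^sup>2 * H b a\<bar> + \<bar>Q t - t\<^sup>2 * H a b\<bar>"
    by (rule abs_triangle_ineq4)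
  also have "\<dots> \<le> e * t\<^sup>2 * (2 * norm a + norm b) + e * t\<^sup>2 * (2 * norm b + norm a)"
    using Qa t(1,2) Qb t(1,3) by (intro add_mono) auto
  also have "\<dots> = t\<^sup>2 * (e * K)" unfolding K_def by (simp add: algebra_simps)
  finally have "\<bar>H a b - H b a\<bar> \<le> e * K" using t by simp
  moreover have "e * K < \<bar>H a b - H b a\<bar>"
    unfolding e_def using ne K by (simp add: field_simps)
  ultimately show False by simp
qed

lemma perm_invariant_from_tail_and_swap:
  assumes tail: "\<And>a t t'. length t = n \<Longrightarrow> mset t = mset t' \<Longrightarrow> F (a # t) = F (a # t')"
    and swap: "\<And>a b t. Suc (length t) = n \<Longrightarrow> F (a # b # t) = F (b # a # t)"
    and len: "length xs = Suc n" and ms: "mset xs = mset ys"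
  shows "F xs = F ys"
proof -
  obtain a t where xs: "xs = a # t" using len by (cases xs) auto
  obtain b t' where ys: "ys = b # t'" using len mset_eq_length[OF ms] by (cases ys) auto
  have t: "length t = n" "length t' = n" using len mset_eq_length[OF ms] xs ys by auto
  show ?thesis
  proof (cases "a = b")
    case True
    then have "mset t = mset t'" using ms xs ys by simp
    then show ?thesis using tail[where a = a, OF t(1)] xs ys True by simp
  next
    case False
    have "a \<in># mset ys" using ms xs by (metis list.set_intros(1) set_mset_mset)
    then have "a \<in> set t'" using False ys by simp
    define r where "r = remove1 a t'"
    have t': "mset t' = mset (a # r)" unfolding r_def using \<open>a \<in> set t'\<close> by simp
    have r: "Suc (length r) = n" using mset_eq_length[OF t'] t(2) by simp
    have "add_mset a (mset t) = add_mset a (mset (b # r))" using ms xs ys t' by simp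
    then have t_br: "mset t = mset (b # r)" by simp
    have "F ys = F (b # a # r)" using tail[where a = b, OF t(2) t'] ys by simp
    also have "\<dots> = F (a # b # r)" using swap[where a = b and b = a, OF r] by simp
    also have "\<dots> = F xs" using tail[where a = a, OF t(1) t_br] xs by simp
    finally show ?thesis by simp
  qed
qed

lemma derivs_upto_has_derivative:
  assumes "derivs_upto p f D U" "k < p" "z \<in> U" "length hs = k"
  shows "((\<lambda>z. D k z hs) has_derivative (\<lambda>v. D (Suc k) z (v # hs))) (at z)"
  using assms unfolding derivs_upto_def by blast

lemma derivs_upto_linear:
  assumes "derivs_upto p f D U" "k < p" "z \<in> U" "length hs = k"
  shows "linear (\<lambda>v. D (Suc k) z (v # hs))"
  using has_derivative_linear[OF derivs_upto_has_derivative[OF assms]] .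

lemma derivs_upto_perm:
  fixes D :: "nat \<Rightarrow> 'a::euclidean_space \<Rightarrow> 'a list \<Rightarrow> real"
  assumes fD: "derivs_upto p f D U" and U: "open U"
  shows "k \<le> p \<Longrightarrow> y \<in> U \<Longrightarrow> length hs = k \<Longrightarrow> mset hs = mset hs' \<Longrightarrow> D k y hs = D k y hs'"
proof (induction k arbitrary: y hs hs')
  case (Suc k)
  show ?case
  proof (rule perm_invariant_from_tail_and_swap[where F = "D (Suc k) y" and n = k])
    fix a :: 'a and t t' :: "'a list" assume t: "length t = k" and mt: "mset t = mset t'"
    have k: "k < p" using Suc.prems by simp
    have "((\<lambda>z. D k z t') has_derivative (\<lambda>v. D (Suc k) y (v # t))) (at y)"
    proof (rule has_derivative_transform_within_open[OF derivs_upto_has_derivative[OF fD k Suc.prems(2) t] U Suc.prems(2)])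
      fix z assume "z \<in> U"
      then show "D k z t = D k z t'" using Suc.IH[OF less_imp_le[OF k] _ t mt] by blast
    qed
    moreover have "((\<lambda>z. D k z t') has_derivative (\<lambda>v. D (Suc k) y (v # t'))) (at y)"
      using derivs_upto_has_derivative[OF fD k Suc.prems(2)] mset_eq_length[OF mt] t by simp
    ultimately have "(\<lambda>v. D (Suc k) y (v # t)) = (\<lambda>v. D (Suc k) y (v # t'))"
      by (rule has_derivative_unique)
    then show "D (Suc k) y (a # t) = D (Suc k) y (a # t')"
      by (rule fun_cong)
  next
    fix a b :: 'a and t :: "'a list" assume t: "Suc (length t) = k"
    have k: "Suc (length t) < p" using Suc.prems t by simp
    show "D (Suc k) y (a # b # t) = D (Suc k) y (b # a # t)"
      unfolding t[symmetric]
    proof (rule second_derivative_symmetric[OF U Suc.prems(2)])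
      fix z assume "z \<in> U"
      then show "((\<lambda>z. D (length t) z t) has_derivative (\<lambda>v. D (Suc (length t)) z (v # t))) (at z)"
        using derivs_upto_has_derivative[OF fD _ _ refl] k by (meson Suc_lessD)
    next
      fix v
      show "((\<lambda>z. D (Suc (length t)) z (v # t)) has_derivative
          (\<lambda>w. D (Suc (Suc (length t))) y (w # v # t))) (at y)"
        using derivs_upto_has_derivative[OF fD k Suc.prems(2), of "v # t"] by simp
    qed
  qed (simp_all add: Suc.prems(3,4))
qed simp

section \<open>Symmetric multilinear forms\<close>

definition sym_multilinear :: "nat \<Rightarrow> ('a::euclidean_space list \<Rightarrow> real) \<Rightarrow> bool" where
  "sym_multilinear n A \<longleftrightarrow> (\<forall>xs ys. length xs = n \<longrightarrow> mset xs = mset ys \<longrightarrow> A xs = A ys) \<and>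
     (0 < n \<longrightarrow> (\<forall>t. length t = n - 1 \<longrightarrow> linear (\<lambda>v. A (v # t))))"

lemma sym_multilinear_perm:
  "sym_multilinear n A \<Longrightarrow> length xs = n \<Longrightarrow> mset xs = mset ys \<Longrightarrow> A xs = A ys"
  unfolding sym_multilinear_def by blast

lemma sym_multilinear_linear:
  "sym_multilinear n A \<Longrightarrow> 0 < n \<Longrightarrow> length t = n - 1 \<Longrightarrow> linear (\<lambda>v. A (v # t))"
  unfolding sym_multilinear_def by blast

lemma sym_multilinear_Cons:
  assumes "sym_multilinear (Suc n) A"
  shows "sym_multilinear n (\<lambda>t. A (b # t))"
  unfolding sym_multilinear_def
proof (intro conjI allI impI)
  fix xs ys :: "'a list" assume "length xs = n" "mset xs = mset ys"
  then show "A (b # xs) = A (b # ys)" using sym_multilinear_perm[OF assms, of "b # xs"] by simp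
next
  fix t :: "'a list" assume n: "0 < n" and t: "length t = n - 1"
  have "(\<lambda>v. A (b # v # t)) = (\<lambda>v. A (v # b # t))"
    using sym_multilinear_perm[OF assms, of "b # _ # t"] t n by (auto simp: fun_eq_iff)
  then show "linear (\<lambda>v. A (b # v # t))"
    using sym_multilinear_linear[OF assms, of "b # t"] t n by simp
qed

lemma sym_multilinear_scaleR_prefix:
  assumes "sym_multilinear n A"
  shows "length ys + length zs = n \<Longrightarrow> A (map ((*\<^sub>R) c) ys @ zs) = c ^ length ys * A (ys @ zs)"
proof (induction ys arbitrary: zs)
  case (Cons y ys)
  have "A (map ((*\<^sub>R) c) (y # ys) @ zs) = A (map ((*\<^sub>R) c) ys @ (c *\<^sub>R y # zs))"
    using sym_multilinear_perm[OF assms, of "map ((*\<^sub>R) c) (y # ys) @ zs"] Cons.prems by simp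
  also have "\<dots> = c ^ length ys * A (ys @ (c *\<^sub>R y # zs))"
    using Cons.IH[of "c *\<^sub>R y # zs"] Cons.prems by simp
  also have "A (ys @ (c *\<^sub>R y # zs)) = A (c *\<^sub>R y # ys @ zs)"
    using sym_multilinear_perm[OF assms, of "ys @ (c *\<^sub>R y # zs)"] Cons.prems by simp
  also have "\<dots> = c * A (y # ys @ zs)"
    using linear_cmul[OF sym_multilinear_linear[OF assms _, of "ys @ zs"]] Cons.prems by simp
  finally show ?case by simp
qed simp

lemma sym_multilinear_continuous:
  "sym_multilinear n A \<Longrightarrow> (\<And>i. i < n \<Longrightarrow> continuous_on S (g i)) \<Longrightarrow>
     continuous_on S (\<lambda>t. A (map (\<lambda>i. g i t) [0..<n]))"
proof (induction n arbitrary: A g)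
  case (Suc n)
  have expand: "A (map (\<lambda>i. g i t) [0..<Suc n]) =
      (\<Sum>b\<in>Basis. (g 0 t \<bullet> b) * A (b # map (\<lambda>i. g (Suc i) t) [0..<n]))" for t
  proof -
    have "linear (\<lambda>v. A (v # map (\<lambda>i. g (Suc i) t) [0..<n]))"
      using sym_multilinear_linear[OF Suc.prems(1)] by simp
    from linear_functional_Basis_expansion[OF this, of "g 0 t"] show ?thesis
      by (simp only: map_upt_Suc)
  qed
  have "continuous_on S (\<lambda>t. A (b # map (\<lambda>i. g (Suc i) t) [0..<n]))" for b
    using Suc.IH[OF sym_multilinear_Cons[OF Suc.prems(1)], of "\<lambda>i. g (Suc i)"] Suc.prems(2) by simp
  moreover have "continuous_on S (g 0)" using Suc.prems(2) by simp
  ultimately show ?case unfolding expand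
    by (intro continuous_on_sum continuous_on_mult continuous_on_inner continuous_on_const) auto
qed simp

lemma map_upt_fun_upd: "i < n \<Longrightarrow> map (f(i := v)) [0..<n] = (map f [0..<n])[i := v]"
  by (rule nth_equalityI) (auto simp: nth_list_update)

lemma sym_multilinear_two_slots:
  assumes A: "sym_multilinear p A" and xs: "length xs = p" and j: "0 < j" "j < p"
  obtains Z where "bilinear (\<lambda>a c. A (a # c # Z))" "\<And>a c. A (a # c # Z) = A (c # a # Z)"
    "\<And>a c. A (xs[0 := a, j := c]) = A (a # c # Z)"
proof -
  obtain x0 ys where xs_eq: "xs = x0 # ys" using xs j by (cases xs) auto
  define Z where "Z = take (j - 1) ys @ drop j ys"
  have ys: "length ys = p - 1" using xs xs_eq by auto
  have Z: "length Z = p - 2" unfolding Z_def using ys j by auto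
  have sym: "A (a # c # Z) = A (c # a # Z)" for a c
    using sym_multilinear_perm[OF A, of "a # c # Z" "c # a # Z"] Z j by simp
  have bil: "bilinear (\<lambda>a c. A (a # c # Z))"
    unfolding bilinear_def
  proof (intro conjI allI)
    fix a c
    show "linear (\<lambda>a. A (a # c # Z))"
      using sym_multilinear_linear[OF A _, of "c # Z"] Z j by simp
    show "linear (\<lambda>c. A (a # c # Z))"
      using sym_multilinear_linear[OF A _, of "a # Z"] Z j sym[of _ a] by simp
  qed
  have upd: "A (xs[0 := a, j := c]) = A (a # c # Z)" for a c
  proof -
    have "xs[0 := a, j := c] = a # ys[j - 1 := c]" using xs_eq j by (cases j) simp_all
    moreover have "mset (a # ys[j - 1 := c]) = mset (a # c # Z)"
      unfolding Z_def using ys j by (simp add: mset_update upd_conv_take_nth_drop)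
    ultimately show ?thesis using sym_multilinear_perm[OF A, of "a # ys[j - 1 := c]"] ys j by simp
  qed
  show ?thesis by (rule that[OF bil sym upd])
qed

section \<open>The norm induced by \<open>B\<close> and Banach's theorem on symmetric forms\<close>

definition Binner :: "('a::euclidean_space \<Rightarrow> 'a) \<Rightarrow> 'a \<Rightarrow> 'a \<Rightarrow> real" where
  "Binner B x y = inner (B x) y"

definition Bsphere :: "('a::euclidean_space \<Rightarrow> 'a) \<Rightarrow> 'a set" where
  "Bsphere B = {v. Bnorm B v = 1}"

text \<open>Tuples of length \<open>p\<close> are functions on \<open>nat\<close> padded with \<open>0\<close> beyond \<open>p\<close>, so that the tuples
  of unit vectors form a compact subset of a product space.\<close>

definition unit_tuples :: "('a::euclidean_space \<Rightarrow> 'a) \<Rightarrow> nat \<Rightarrow> (nat \<Rightarrow> 'a) set" where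
  "unit_tuples B p = (\<Pi>\<^sub>E i\<in>UNIV. if i < p then Bsphere B else {0})"

lemma unit_tuples_iff:
  "f \<in> unit_tuples B p \<longleftrightarrow> (\<forall>i. (i < p \<longrightarrow> f i \<in> Bsphere B) \<and> (\<not> i < p \<longrightarrow> f i = 0))"
  unfolding unit_tuples_def by (auto simp: PiE_iff)

lemma unit_tuples_upd:
  "f \<in> unit_tuples B p \<Longrightarrow> i < p \<Longrightarrow> v \<in> Bsphere B \<Longrightarrow> f(i := v) \<in> unit_tuples B p"
  unfolding unit_tuples_iff by simp

context
  fixes B :: "'a::euclidean_space \<Rightarrow> 'a"
  assumes B: "self_adjoint_pd B"
begin

lemma B_linear: "linear B"
  using B unfolding self_adjoint_pd_def by blast

lemma bilinear_Binner: "bilinear (Binner B)"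
  unfolding bilinear_def Binner_def
proof (intro conjI allI)
  show "linear (\<lambda>y. inner (B x) y)" for x
    using bounded_linear.linear[OF bounded_linear_inner_right] .
  show "linear (\<lambda>x. inner (B x) y)" for y
    using linear_compose[OF B_linear bounded_linear.linear[OF bounded_linear_inner_left]]
    by (simp add: o_def)
qed

lemmas Binner_zero [simp] = bilinear_lzero[OF bilinear_Binner] bilinear_rzero[OF bilinear_Binner]

lemmas Binner_simps = bilinear_ladd[OF bilinear_Binner] bilinear_radd[OF bilinear_Binner]
  bilinear_lmul[OF bilinear_Binner] bilinear_rmul[OF bilinear_Binner]
  bilinear_lneg[OF bilinear_Binner] bilinear_rneg[OF bilinear_Binner]
  bilinear_lsub[OF bilinear_Binner] bilinear_rsub[OF bilinear_Binner]

lemma Binner_commute: "Binner B x y = Binner B y x"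
  using B unfolding self_adjoint_pd_def Binner_def by (simp add: inner_commute)

lemma Binner_self_pos: "x \<noteq> 0 \<Longrightarrow> Binner B x x > 0"
  using B unfolding self_adjoint_pd_def Binner_def by blast

lemma Binner_self_nonneg: "Binner B x x \<ge> 0"
  using Binner_self_pos[of x] by (cases "x = 0") auto

lemma Binner_self_eq_0: "Binner B x x = 0 \<longleftrightarrow> x = 0"
  using Binner_self_pos[of x] by (cases "x = 0") auto

lemma Bnorm_Binner: "Bnorm B x = sqrt (Binner B x x)"
  unfolding Bnorm_def Binner_def by simp

lemma Bnorm_power2: "(Bnorm B x)\<^sup>2 = Binner B x x"
  unfolding Bnorm_Binner using Binner_self_nonneg[of x] by simp

lemma Bnorm_nonneg: "Bnorm B x \<ge> 0"
  unfolding Bnorm_Binner using Binner_self_nonneg by simp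

lemma Bnorm_eq_0: "Bnorm B x = 0 \<longleftrightarrow> x = 0"
  unfolding Bnorm_Binner using Binner_self_eq_0 Binner_self_nonneg by simp

lemma Bnorm_pos: "x \<noteq> 0 \<Longrightarrow> Bnorm B x > 0"
  using Bnorm_eq_0[of x] Bnorm_nonneg[of x] by linarith

lemma Bsphere_iff_Binner: "v \<in> Bsphere B \<longleftrightarrow> Binner B v v = 1"
  unfolding Bsphere_def Bnorm_Binner by simp

lemma Bnorm_scaleR: "Bnorm B (c *\<^sub>R x) = \<bar>c\<bar> * Bnorm B x"
proof -
  have "Binner B (c *\<^sub>R x) (c *\<^sub>R x) = c\<^sup>2 * Binner B x x"
    by (simp add: Binner_simps power2_eq_square)
  then show ?thesis unfolding Bnorm_Binner by (simp add: real_sqrt_mult)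
qed

lemma Bnorm_normalize:
  assumes "x \<noteq> 0"
  shows "(1 / Bnorm B x) *\<^sub>R x \<in> Bsphere B" "x = Bnorm B x *\<^sub>R ((1 / Bnorm B x) *\<^sub>R x)"
  using Bnorm_pos[OF assms] by (simp_all add: Bsphere_def Bnorm_scaleR)

lemma continuous_on_Binner [continuous_intros]:
  assumes "continuous_on S f" "continuous_on S g"
  shows "continuous_on S (\<lambda>t. Binner B (f t) (g t))"
proof -
  have "continuous_on S (\<lambda>t. B (f t))"
    using linear_continuous_on[OF linear_conv_bounded_linear[THEN iffD1, OF B_linear]]
    by (rule continuous_on_compose2[OF _ assms(1)]) auto
  then show ?thesis unfolding Binner_def by (intro continuous_intros assms)
qed

lemma continuous_on_Bnorm [continuous_intros]:
  "continuous_on S f \<Longrightarrow> continuous_on S (\<lambda>t. Bnorm B (f t))"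
  unfolding Bnorm_Binner by (intro continuous_intros)

lemma Binner_coercive: "\<exists>m>0. \<forall>x. Binner B x x \<ge> m * (norm x)\<^sup>2"
proof -
  have "continuous_on (sphere 0 1) (\<lambda>x. Binner B x x)"
    by (intro continuous_intros continuous_on_id)
  moreover have "sphere (0::'a) 1 \<noteq> {}" by simp
  ultimately obtain x0 where x0: "x0 \<in> sphere 0 1"
    and min: "\<forall>y\<in>sphere 0 1. Binner B x0 x0 \<le> Binner B y y"
    using continuous_attains_inf[OF compact_sphere] by blast
  have "Binner B x x \<ge> Binner B x0 x0 * (norm x)\<^sup>2" for x
  proof (cases "x = 0")
    case False
    define u where "u = (1 / norm x) *\<^sub>R x"
    have "Binner B x x = (norm x)\<^sup>2 * Binner B u u"
      unfolding u_def using False by (simp add: Binner_simps power2_eq_square)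
    moreover have "Binner B x0 x0 \<le> Binner B u u" using min False unfolding u_def by simp
    ultimately show ?thesis by (simp add: mult.commute mult_right_mono)
  qed simp
  moreover have "x0 \<noteq> 0" using x0 by auto
  then have "Binner B x0 x0 > 0" by (rule Binner_self_pos)
  ultimately show ?thesis by blast
qed

lemma compact_Bball: "compact {v. Bnorm B v \<le> 1}"
  unfolding compact_eq_bounded_closed
proof
  obtain m where m: "m > 0" "\<And>x. Binner B x x \<ge> m * (norm x)\<^sup>2" using Binner_coercive by blast
  have "norm x \<le> sqrt (1 / m)" if "Bnorm B x \<le> 1" for x
  proof (rule real_le_rsqrt)
    have "Binner B x x \<le> 1"
      using that Bnorm_power2[of x] Bnorm_nonneg[of x] by (metis power_le_one)
    then show "(norm x)\<^sup>2 \<le> 1 / m" using m(1) m(2)[of x] by (simp add: field_simps)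
  qed
  then show "bounded {v. Bnorm B v \<le> 1}" unfolding bounded_iff by blast
  show "closed {v. Bnorm B v \<le> 1}"
    by (intro closed_Collect_le continuous_intros continuous_on_id)
qed

lemma compact_Bsphere: "compact (Bsphere B)"
proof -
  have "Bsphere B = {v. Bnorm B v \<le> 1} \<inter> {v. Bnorm B v = 1}" by (auto simp: Bsphere_def)
  moreover have "closed {v. Bnorm B v = 1}"
    by (intro closed_Collect_eq continuous_intros continuous_on_id)
  ultimately show ?thesis using compact_Int_closed[OF compact_Bball] by simp
qed

lemma Bsphere_nonempty: "Bsphere B \<noteq> {}"
proof -
  obtain b :: 'a where "b \<in> Basis" using nonempty_Basis by blast
  then have "b \<noteq> 0" by (rule nonzero_Basis)
  then show ?thesis using Bnorm_normalize(1) by blast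
qed

lemma Bsphere_polar:
  obtains v where "v \<in> Bsphere B" "x = Bnorm B x *\<^sub>R v"
proof (cases "x = 0")
  case True
  obtain v where "v \<in> Bsphere B" using Bsphere_nonempty by blast
  moreover have "x = Bnorm B x *\<^sub>R v" using True Bnorm_eq_0[of x] by simp
  ultimately show ?thesis by (rule that)
next
  case False
  then show ?thesis using that Bnorm_normalize by blast
qed

lemma B_inj: "inj B"
proof (rule injI)
  fix y z assume "B y = B z"
  then have "Binner B (y - z) (y - z) = 0"
    unfolding Binner_def by (simp add: linear_diff[OF B_linear])
  then show "y = z" using Binner_self_eq_0 by simp
qed

lemma B_inv_cancel: "B (inv B g) = g"
  using linear_inj_imp_surj[OF B_linear B_inj] by (simp add: surj_f_inv_f)

lemma Bdnorm_eq_Bnorm_inv: "Bdnorm B g = Bnorm B (inv B g)"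
  unfolding Bdnorm_def Bnorm_def by (metis B_inv_cancel)

lemma compact_unit_tuples:
  shows "compact (unit_tuples B p)"
proof -
  have "compactin (product_topology (\<lambda>i. euclidean) UNIV) (unit_tuples B p)"
    unfolding unit_tuples_def compactin_PiE using compact_Bsphere by auto
  then show ?thesis by (simp add: euclidean_product_topology)
qed

lemma unit_tuples_nonempty:
  shows "unit_tuples B p \<noteq> {}"
proof -
  obtain v where "v \<in> Bsphere B" using Bsphere_nonempty by blast
  then have "(\<lambda>i. if i < p then v else 0) \<in> unit_tuples B p" by (simp add: unit_tuples_iff)
  then show ?thesis by blast
qed

lemma Binner_lt_by_sign:
  assumes e: "e \<in> Bsphere B" and s: "0 \<le> s" "s < 2"
  obtains \<sigma> :: real where "\<bar>\<sigma>\<bar> = 1"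
    "Binner B (s *\<^sub>R e + R) (s *\<^sub>R e + R) < Binner B (2 *\<^sub>R (\<sigma> *\<^sub>R e) + R) (2 *\<^sub>R (\<sigma> *\<^sub>R e) + R)"
proof
  define \<sigma> where "\<sigma> = (if Binner B R e \<ge> 0 then 1 else - 1 :: real)"
  show "\<bar>\<sigma>\<bar> = 1" unfolding \<sigma>_def by simp
  have ee: "Binner B e e = 1" using e by (simp add: Bsphere_iff_Binner)
  have "Binner B (s *\<^sub>R e + R) (s *\<^sub>R e + R) = s\<^sup>2 * Binner B e e + 2 * s * Binner B R e + Binner B R R"
    by (simp add: Binner_simps Binner_commute[of e R] power2_eq_square algebra_simps)
  also have "\<dots> < 4 + 4 * \<bar>Binner B R e\<bar> + Binner B R R"
  proof -
    have "s\<^sup>2 < 2\<^sup>2" using s by (intro power_strict_mono) auto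
    moreover have "s * Binner B R e \<le> s * \<bar>Binner B R e\<bar>"
      using s(1) by (simp add: mult_left_mono)
    moreover have "s * \<bar>Binner B R e\<bar> \<le> 2 * \<bar>Binner B R e\<bar>"
      using s(2) by (simp add: mult_right_mono)
    ultimately show ?thesis using ee by simp
  qed
  also have "4 * \<bar>Binner B R e\<bar> = 4 * (\<sigma> * Binner B R e)" unfolding \<sigma>_def by simp
  also have "4 + 4 * (\<sigma> * Binner B R e) + Binner B R R
      = Binner B (2 *\<^sub>R (\<sigma> *\<^sub>R e) + R) (2 *\<^sub>R (\<sigma> *\<^sub>R e) + R)"
    using ee \<open>\<bar>\<sigma>\<bar> = 1\<close>
    by (simp add: Binner_simps Binner_commute[of e R] algebra_simps abs_mult_self_eq[of \<sigma>, symmetric])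
  finally show "Binner B (s *\<^sub>R e + R) (s *\<^sub>R e + R) < Binner B (2 *\<^sub>R (\<sigma> *\<^sub>R e) + R) (2 *\<^sub>R (\<sigma> *\<^sub>R e) + R)" .
qed

lemma Binner_parallelogram:
  assumes "x1 \<in> Bsphere B" "x2 \<in> Bsphere B"
  shows "Binner B (x1 + x2) (x1 + x2) + Binner B (x1 - x2) (x1 - x2) = 4"
  using assms by (simp add: Bsphere_iff_Binner Binner_simps Binner_commute[of x2 x1])

lemma bilinear_extremal_sum:
  assumes b: "bilinear b" "\<And>x y. b x y = b y x"
    and bound: "\<And>w. \<bar>b w w\<bar> \<le> S * Binner B w w"
    and x: "x1 \<in> Bsphere B" "x2 \<in> Bsphere B" and S: "\<bar>b x1 x2\<bar> = S"
  shows "\<bar>b (x1 + x2) (x1 + x2)\<bar> = S * Binner B (x1 + x2) (x1 + x2)"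
proof -
  define wp where "wp = x1 + x2"
  define wm where "wm = x1 - x2"
  have polar: "b wp wp - b wm wm = 4 * b x1 x2"
    unfolding wp_def wm_def
    by (simp add: bilinear_ladd[OF b(1)] bilinear_radd[OF b(1)] bilinear_lsub[OF b(1)]
        bilinear_rsub[OF b(1)] b(2)[of x2 x1])
  define \<epsilon> where "\<epsilon> = (if b x1 x2 \<ge> 0 then 1 else - 1 :: real)"
  have \<epsilon>: "\<epsilon> * b x1 x2 = S" "\<bar>\<epsilon> * y\<bar> = \<bar>y\<bar>" for y unfolding \<epsilon>_def using S by auto
  have "\<epsilon> * b wp wp \<le> S * Binner B wp wp" "- (\<epsilon> * b wm wm) \<le> S * Binner B wm wm"
    using bound[of wp] bound[of wm] \<epsilon>(2)[of "b wp wp"] \<epsilon>(2)[of "b wm wm"] by linarith+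
  moreover have "\<epsilon> * b wp wp - \<epsilon> * b wm wm = S * (Binner B wp wp + Binner B wm wm)"
    using polar \<epsilon>(1) Binner_parallelogram[OF x] unfolding wp_def wm_def
    by (simp add: right_diff_distrib[symmetric])
  ultimately have "\<epsilon> * b wp wp = S * Binner B wp wp" by (simp add: distrib_left)
  then show ?thesis
    using \<epsilon>(2)[of "b wp wp"] S Binner_self_nonneg[of wp] unfolding wp_def by simp
qed

lemma bilinear_extremal_pair:
  assumes b: "bilinear b" "\<And>x y. b x y = b y x"
    and bound: "\<And>w. \<bar>b w w\<bar> \<le> S * Binner B w w"
    and x: "x1 \<in> Bsphere B" "x2 \<in> Bsphere B" "x1 \<noteq> x2" and S: "\<bar>b x1 x2\<bar> = S"
  obtains e s where "e \<in> Bsphere B" "\<bar>b e e\<bar> = S" "0 \<le> s" "s < 2" "x1 + x2 = s *\<^sub>R e"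
proof (cases "x1 + x2 = 0")
  case True
  then have "x2 = - x1" by (simp add: add_eq_0_iff2)
  then have "\<bar>b x1 x1\<bar> = S" using S bilinear_rneg[OF b(1)] by simp
  then show ?thesis using that[of x1 0] x(1) True by simp
next
  case False
  define wp where "wp = x1 + x2"
  have wp: "wp \<noteq> 0" using False unfolding wp_def .
  define e where "e = (1 / Bnorm B wp) *\<^sub>R wp"
  have e: "e \<in> Bsphere B" "wp = Bnorm B wp *\<^sub>R e"
    unfolding e_def using Bnorm_normalize[OF wp] by auto
  have "(Bnorm B wp)\<^sup>2 * \<bar>b e e\<bar> = \<bar>b wp wp\<bar>"
    using e(2) bilinear_lmul[OF b(1)] bilinear_rmul[OF b(1)]
    by (metis abs_mult abs_of_nonneg power2_eq_square zero_le_power2 mult.assoc real_scaleR_def)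
  then have "\<bar>b e e\<bar> = S"
    using bilinear_extremal_sum[OF b bound x(1,2) S] Bnorm_power2[of wp] Binner_self_pos[OF wp]
    unfolding wp_def by (simp add: mult.commute)
  moreover have "Bnorm B wp < 2"
  proof -
    have "Binner B (x1 - x2) (x1 - x2) > 0" using x(3) Binner_self_pos by simp
    then have "(Bnorm B wp)\<^sup>2 < 2\<^sup>2"
      using Bnorm_power2[of wp] Binner_parallelogram[OF x(1,2)] unfolding wp_def by simp
    then show ?thesis by (rule power_less_imp_less_base) simp
  qed
  ultimately show ?thesis using that[of e "Bnorm B wp"] e Bnorm_nonneg unfolding wp_def by simp
qed

lemma bilinear_bound_from_Bsphere:
  assumes b: "bilinear b" and unit: "\<And>v. v \<in> Bsphere B \<Longrightarrow> \<bar>b v v\<bar> \<le> S"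
  shows "\<bar>b w w\<bar> \<le> S * Binner B w w"
proof -
  obtain v where v: "v \<in> Bsphere B" "w = Bnorm B w *\<^sub>R v" by (rule Bsphere_polar)
  define n where "n = Bnorm B w"
  have "b w w = n\<^sup>2 * b v v"
    unfolding v(2)[folded n_def] by (simp add: bilinear_lmul[OF b] bilinear_rmul[OF b] power2_eq_square)
  then have "\<bar>b w w\<bar> = n\<^sup>2 * \<bar>b v v\<bar>" by (simp add: abs_mult)
  also have "\<dots> \<le> n\<^sup>2 * S" using unit[OF v(1)] by (simp add: mult_left_mono)
  finally show ?thesis unfolding n_def by (simp add: Bnorm_power2 mult.commute)
qed

lemma sum_lessThan_remove_two:
  fixes h :: "nat \<Rightarrow> 'b::comm_monoid_add"
  assumes "0 < j" "j < p"
  shows "(\<Sum>k<p. h k) = h 0 + h j + (\<Sum>k\<in>{..<p} - {0, j}. h k)"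
proof -
  have "(\<Sum>k<p. h k) = h 0 + (\<Sum>k\<in>{..<p} - {0}. h k)"
    using sum.remove[of "{..<p}" 0 h] assms by simp
  also have "(\<Sum>k\<in>{..<p} - {0}. h k) = h j + (\<Sum>k\<in>{..<p} - {0} - {j}. h k)"
    using sum.remove[of "{..<p} - {0}" j h] assms by simp
  also have "{..<p} - {0} - {j} = {..<p} - {0, j}" by auto
  finally show ?thesis by (simp add: add.assoc)
qed

text \<open>Two distinct entries of a tuple maximizing \<open>\<bar>A\<bar>\<close> can be replaced by one unit vector
  \<open>e\<close> or \<open>-e\<close> along their sum: \<open>\<bar>A\<bar>\<close> stays maximal while the sum of the entries gets strictly longer.
  Hence the tuple maximizing the length of its sum among the maximizers of \<open>\<bar>A\<bar>\<close> is constant.\<close>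

lemma unit_tuple_improve:
  assumes A: "sym_multilinear p A" and f: "f \<in> unit_tuples B p"
    and max: "\<And>g. g \<in> unit_tuples B p \<Longrightarrow> \<bar>A (map g [0..<p])\<bar> \<le> \<bar>A (map f [0..<p])\<bar>"
    and j: "j < p" "f j \<noteq> f 0"
  obtains g where "g \<in> unit_tuples B p" "\<bar>A (map g [0..<p])\<bar> = \<bar>A (map f [0..<p])\<bar>"
    "Binner B (\<Sum>k<p. f k) (\<Sum>k<p. f k) < Binner B (\<Sum>k<p. g k) (\<Sum>k<p. g k)"
proof -
  define S where "S = \<bar>A (map f [0..<p])\<bar>"
  have j0: "0 < j" using j(2) by (cases j) auto
  have len: "length (map f [0..<p]) = p" by simp
  obtain Z where bil: "bilinear (\<lambda>a c. A (a # c # Z))" and sym: "\<And>a c. A (a # c # Z) = A (c # a # Z)"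
    and upd: "\<And>a c. A ((map f [0..<p])[0 := a, j := c]) = A (a # c # Z)"
    using sym_multilinear_two_slots[OF A len j0 j(1)] by blast
  have V_upd: "A (map (f(0 := a, j := c)) [0..<p]) = A (a # c # Z)" for a c
    using upd[of a c] j j0 by (simp add: map_upt_fun_upd)
  have p0: "0 < p" using j(1) by simp
  have "\<bar>A (v # v # Z)\<bar> \<le> S" if "v \<in> Bsphere B" for v
    using max[OF unit_tuples_upd[OF unit_tuples_upd[OF f p0 that] j(1) that]]
    unfolding V_upd S_def .
  then have bound: "\<bar>A (w # w # Z)\<bar> \<le> S * Binner B w w" for w
    by (rule bilinear_bound_from_Bsphere[OF bil])
  have x: "f 0 \<in> Bsphere B" "f j \<in> Bsphere B" using f j j0 by (auto simp: unit_tuples_iff)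
  have "\<bar>A (f 0 # f j # Z)\<bar> = S" using V_upd[of "f 0" "f j"] unfolding S_def by simp
  then obtain e s where e: "e \<in> Bsphere B" "\<bar>A (e # e # Z)\<bar> = S"
    and s: "0 \<le> s" "s < 2" and sum: "f 0 + f j = s *\<^sub>R e"
    using bilinear_extremal_pair[OF bil sym bound x j(2)[symmetric]] by blast
  define R where "R = (\<Sum>k\<in>{..<p} - {0, j}. f k)"
  obtain \<sigma> :: real where \<sigma>: "\<bar>\<sigma>\<bar> = 1"
    and lt: "Binner B (s *\<^sub>R e + R) (s *\<^sub>R e + R) < Binner B (2 *\<^sub>R (\<sigma> *\<^sub>R e) + R) (2 *\<^sub>R (\<sigma> *\<^sub>R e) + R)"
    using Binner_lt_by_sign[OF e(1) s] by blast
  define g where "g = f(0 := \<sigma> *\<^sub>R e, j := \<sigma> *\<^sub>R e)"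
  have "\<sigma> *\<^sub>R e \<in> Bsphere B" using e(1) \<sigma> by (simp add: Bsphere_def Bnorm_scaleR)
  then have "g \<in> unit_tuples B p" unfolding g_def using f j j0 by (simp add: unit_tuples_upd)
  moreover have "\<bar>A (map g [0..<p])\<bar> = S"
    unfolding g_def V_upd using e(2) \<sigma> bilinear_lmul[OF bil] bilinear_rmul[OF bil] by (simp add: abs_mult)
  moreover have "(\<Sum>k<p. f k) = s *\<^sub>R e + R" "(\<Sum>k<p. g k) = 2 *\<^sub>R (\<sigma> *\<^sub>R e) + R"
  proof -
    have "(\<Sum>k\<in>{..<p} - {0, j}. g k) = R" unfolding R_def g_def by (rule sum.cong) auto
    then have "(\<Sum>k<p. g k) = \<sigma> *\<^sub>R e + \<sigma> *\<^sub>R e + R"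
      using sum_lessThan_remove_two[OF j0 j(1), of g] j0 unfolding g_def by simp
    then show "(\<Sum>k<p. g k) = 2 *\<^sub>R (\<sigma> *\<^sub>R e) + R" by (simp only: scaleR_2)
    show "(\<Sum>k<p. f k) = s *\<^sub>R e + R"
      using sum_lessThan_remove_two[OF j0 j(1), of f] sum unfolding R_def by simp
  qed
  ultimately show ?thesis using that lt unfolding S_def by simp
qed

lemma exists_constant_maximizing_unit_tuple:
  assumes A: "sym_multilinear p A"
  obtains f where "f \<in> unit_tuples B p"
    "\<And>g. g \<in> unit_tuples B p \<Longrightarrow> \<bar>A (map g [0..<p])\<bar> \<le> \<bar>A (map f [0..<p])\<bar>"
    "\<And>j. j < p \<Longrightarrow> f j = f 0"
proof -
  define V where "V g = \<bar>A (map g [0..<p])\<bar>" for g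
  define \<Phi> where "\<Phi> g = Binner B (\<Sum>k<p. g k) (\<Sum>k<p. g k)" for g :: "nat \<Rightarrow> 'a"
  have "continuous_on UNIV (\<lambda>g. A (map (\<lambda>i. g i) [0..<p]))"
    by (rule sym_multilinear_continuous[OF A]) (rule continuous_on_product_coordinates)
  then have cV: "continuous_on UNIV V" unfolding V_def by (rule continuous_on_rabs)
  from continuous_attains_sup[OF compact_unit_tuples unit_tuples_nonempty continuous_on_subset[OF cV subset_UNIV]]
  obtain f0 where f0: "f0 \<in> unit_tuples B p" "\<forall>g\<in>unit_tuples B p. V g \<le> V f0"
    by blast
  define K where "K = unit_tuples B p \<inter> {g. V g = V f0}"
  have "closed {g. V g = V f0}" by (rule closed_Collect_eq[OF cV continuous_on_const])
  then have K: "compact K" unfolding K_def by (rule compact_Int_closed[OF compact_unit_tuples])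
  have K_ne: "K \<noteq> {}" using f0 unfolding K_def by blast
  have \<Phi>: "continuous_on K \<Phi>" unfolding \<Phi>_def
    by (intro continuous_on_Binner continuous_on_sum continuous_on_subset[OF continuous_on_product_coordinates subset_UNIV])
  from continuous_attains_sup[OF K K_ne \<Phi>]
  obtain f where f: "f \<in> K" "\<forall>g\<in>K. \<Phi> g \<le> \<Phi> f"
    by blast
  have fK: "f \<in> unit_tuples B p" "V f = V f0" using f(1) unfolding K_def by auto
  have max: "V g \<le> V f" if "g \<in> unit_tuples B p" for g using f0(2) that fK(2) by simp
  have "f j = f 0" if j: "j < p" for j
  proof (rule ccontr)
    assume "f j \<noteq> f 0"
    from unit_tuple_improve[OF A fK(1) max[unfolded V_def] j this]
    obtain g where g: "g \<in> unit_tuples B p" "V g = V f" "\<Phi> f < \<Phi> g"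
      unfolding V_def \<Phi>_def by blast
    then have "g \<in> K" unfolding K_def using fK(2) by simp
    then have "\<Phi> g \<le> \<Phi> f" using f(2) by blast
    then show False using g(3) by simp
  qed
  with fK(1) max show ?thesis unfolding V_def by (rule that)
qed

lemma sym_multilinear_bound_by_diagonal:
  assumes A: "sym_multilinear p A" and M: "\<And>v. v \<in> Bsphere B \<Longrightarrow> \<bar>A (replicate p v)\<bar> \<le> M"
    and xs: "length xs = p" "set xs \<subseteq> Bsphere B"
  shows "\<bar>A xs\<bar> \<le> M"
proof (rule exists_constant_maximizing_unit_tuple[OF A])
  fix f assume f: "f \<in> unit_tuples B p"
    and max: "\<And>g. g \<in> unit_tuples B p \<Longrightarrow> \<bar>A (map g [0..<p])\<bar> \<le> \<bar>A (map f [0..<p])\<bar>"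
    and const: "\<And>j. j < p \<Longrightarrow> f j = f 0"
  obtain v where v: "v \<in> Bsphere B" "map f [0..<p] = replicate p v"
  proof (cases "p = 0")
    case True
    obtain v where "v \<in> Bsphere B" using Bsphere_nonempty by blast
    moreover have "map f [0..<p] = replicate p v" using True by simp
    ultimately show ?thesis by (rule that)
  next
    case False
    then have "f 0 \<in> Bsphere B" using f unfolding unit_tuples_iff by blast
    moreover have "map f [0..<p] = replicate p (f 0)"
    proof (rule nth_equalityI)
      fix i assume "i < length (map f [0..<p])"
      then show "map f [0..<p] ! i = replicate p (f 0) ! i" using const[of i] by simp
    qed simp
    ultimately show ?thesis by (rule that)
  qed
  define g where "g i = (if i < p then xs ! i else 0)" for i
  have "xs ! i \<in> Bsphere B" if "i < p" for i using xs that nth_mem by blast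
  then have g: "g \<in> unit_tuples B p" by (simp add: unit_tuples_iff g_def)
  have g_xs: "map g [0..<p] = xs" using xs(1) by (intro nth_equalityI) (simp_all add: g_def)
  have "\<bar>A xs\<bar> \<le> \<bar>A (map f [0..<p])\<bar>" using max[OF g] unfolding g_xs .
  also have "\<dots> = \<bar>A (replicate p v)\<bar>" using v(2) by simp
  also have "\<dots> \<le> M" using M[OF v(1)] .
  finally show ?thesis .
qed

lemma form_norm_upper:
  assumes A: "sym_multilinear p A" and v: "Bnorm B v \<le> 1"
  shows "\<bar>A (replicate p v)\<bar> \<le> form_norm B p A"
proof -
  have "continuous_on UNIV (\<lambda>v. A (map (\<lambda>i. v) [0..<p]))"
    by (rule sym_multilinear_continuous[OF A]) (rule continuous_on_id)
  then have "continuous_on {v. Bnorm B v \<le> 1} (\<lambda>v. \<bar>A (replicate p v)\<bar>)"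
    by (intro continuous_intros) (auto simp: map_replicate_const intro: continuous_on_subset)
  then have "bounded ((\<lambda>v. \<bar>A (replicate p v)\<bar>) ` {v. Bnorm B v \<le> 1})"
    by (intro compact_imp_bounded compact_continuous_image compact_Bball)
  then show ?thesis unfolding form_norm_def
    using v by (intro cSUP_upper bounded_imp_bdd_above) auto
qed

lemma form_norm_mixed_bound:
  assumes A: "sym_multilinear p A" and p: "0 < p"
  shows "\<bar>A (u # replicate (p - 1) r)\<bar> \<le> form_norm B p A * Bnorm B u * Bnorm B r ^ (p - 1)"
proof -
  obtain uh where uh: "uh \<in> Bsphere B" "u = Bnorm B u *\<^sub>R uh" by (rule Bsphere_polar)
  obtain rh where rh: "rh \<in> Bsphere B" "r = Bnorm B r *\<^sub>R rh" by (rule Bsphere_polar)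
  define nu where "nu = Bnorm B u"
  define nr where "nr = Bnorm B r"
  have u_eq: "u = nu *\<^sub>R uh" unfolding nu_def by (rule uh(2))
  have r_eq: "r = nr *\<^sub>R rh" unfolding nr_def by (rule rh(2))
  have "A (u # replicate (p - 1) r) = nu * A (uh # map ((*\<^sub>R) nr) (replicate (p - 1) rh))"
    unfolding u_eq r_eq map_replicate
    using linear_cmul[OF sym_multilinear_linear[OF A p length_replicate]] by simp
  also have "A (uh # map ((*\<^sub>R) nr) (replicate (p - 1) rh))
      = A (map ((*\<^sub>R) nr) (replicate (p - 1) rh) @ [uh])"
    using sym_multilinear_perm[OF A, of "uh # map ((*\<^sub>R) nr) (replicate (p - 1) rh)"] p by simp
  also have "\<dots> = nr ^ (p - 1) * A (replicate (p - 1) rh @ [uh])"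
    using sym_multilinear_scaleR_prefix[OF A, of "replicate (p - 1) rh" "[uh]" nr] p by simp
  also have "A (replicate (p - 1) rh @ [uh]) = A (uh # replicate (p - 1) rh)"
    using sym_multilinear_perm[OF A, of "replicate (p - 1) rh @ [uh]"] p by simp
  finally have eq: "A (u # replicate (p - 1) r) = nu * nr ^ (p - 1) * A (uh # replicate (p - 1) rh)"
    by simp
  have "\<bar>A (replicate p v)\<bar> \<le> form_norm B p A" if "v \<in> Bsphere B" for v
    using form_norm_upper[OF A] that by (simp add: Bsphere_def)
  then have "\<bar>A (uh # replicate (p - 1) rh)\<bar> \<le> form_norm B p A"
    by (rule sym_multilinear_bound_by_diagonal[OF A]) (use p uh(1) rh(1) in auto)
  moreover have "0 \<le> nu * nr ^ (p - 1)" unfolding nu_def nr_def by (simp add: Bnorm_nonneg)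
  ultimately have "\<bar>A (u # replicate (p - 1) r)\<bar> \<le> nu * nr ^ (p - 1) * form_norm B p A"
    unfolding eq abs_mult[of "nu * nr ^ (p - 1)"] by (simp add: mult_left_mono)
  then show ?thesis unfolding nu_def nr_def by (simp only: ac_simps)
qed

lemma shifted_gradient_inequality:
  assumes K: "0 \<le> K" and g: "\<And>u. \<bar>inner g u\<bar> \<le> K * Bnorm B u"
  shows "(Bdnorm B (g - c *\<^sub>R B r))\<^sup>2 + c\<^sup>2 * (Bnorm B r)\<^sup>2 - K\<^sup>2
           \<le> 2 * c * inner (g - c *\<^sub>R B r) (- r)"
proof -
  define w where "w = inv B (g - c *\<^sub>R B r)"
  define z where "z = w + c *\<^sub>R r"
  have Bw: "B w = g - c *\<^sub>R B r" unfolding w_def by (rule B_inv_cancel)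
  have Bz: "B z = g" unfolding z_def using Bw linear_add[OF B_linear] linear_cmul[OF B_linear] by simp
  have "Bnorm B z * Bnorm B z \<le> K * Bnorm B z"
    using g[of z] Bnorm_power2[of z] unfolding Binner_def Bz by (simp add: power2_eq_square)
  then have "Bnorm B z \<le> K"
    using Bnorm_nonneg[of z] K by (cases "Bnorm B z = 0") (simp_all add: mult_le_cancel_right)
  then have "(Bnorm B z)\<^sup>2 \<le> K\<^sup>2" using Bnorm_nonneg[of z] by (simp add: power_mono)
  moreover have "(Bnorm B z)\<^sup>2 = (Bnorm B w)\<^sup>2 + 2 * c * Binner B w r + c\<^sup>2 * (Bnorm B r)\<^sup>2"
    unfolding z_def Bnorm_power2 by (simp add: Binner_simps Binner_commute[of r w] power2_eq_square algebra_simps)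
  moreover have "Binner B w r = - inner (g - c *\<^sub>R B r) (- r)" unfolding Binner_def Bw by simp
  moreover have "Bdnorm B (g - c *\<^sub>R B r) = Bnorm B w" unfolding w_def by (rule Bdnorm_eq_Bnorm_inv)
  ultimately show ?thesis by (simp add: algebra_simps)
qed

end

section \<open>Taylor approximation of the gradient\<close>

lemma has_real_derivative_power_div_fact:
  assumes "0 < k"
  shows "((\<lambda>t::real. c * t ^ k / fact k) has_real_derivative c * t ^ (k - 1) / fact (k - 1)) (at t)"
proof -
  have "((\<lambda>t::real. c * t ^ k / fact k) has_real_derivative c * (of_nat k * t ^ (k - 1)) / fact k) (at t)"
    by (auto intro!: derivative_eq_intros)
  moreover have "c * (of_nat k * t ^ (k - 1)) / fact k = c * t ^ (k - 1) / fact (k - 1)"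
  proof -
    obtain k' where k: "k = Suc k'" using assms by (cases k) auto
    have "c * (of_nat k * t ^ (k - 1)) / fact k = (of_nat (Suc k') * (c * t ^ k')) / (of_nat (Suc k') * fact k')"
      unfolding k by (simp only: fact_Suc of_nat_mult diff_Suc_1 ac_simps)
    also have "\<dots> = c * t ^ k' / fact k'"
      by (rule nonzero_mult_divide_mult_cancel_left) simp
    finally show ?thesis unfolding k by simp
  qed
  ultimately show ?thesis by simp
qed

lemma taylor_remainder_signed_bound:
  fixes dd :: "nat \<Rightarrow> real \<Rightarrow> real"
  assumes n: "0 < n" and sg: "\<sigma> = 1 \<or> \<sigma> = -1"
    and der: "\<And>m t. m < n \<Longrightarrow> 0 \<le> t \<Longrightarrow> t \<le> 1 \<Longrightarrow> (dd m has_real_derivative dd (Suc m) t) (at t)"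
    and rem: "\<And>t. 0 \<le> t \<Longrightarrow> t \<le> 1 \<Longrightarrow> \<bar>dd n t - dd n 0\<bar> \<le> c * t"
  shows "\<sigma> * (\<Sum>m\<le>n. dd m 0 / fact m) \<le> \<sigma> * dd 0 1 + c / fact (Suc n)"
proof -
  \<comment> \<open>\<open>G m\<close> is the \<open>m\<close>-th derivative of \<open>\<lambda>t. \<sigma> * dd 0 t + c * t ^ (n + 1) / fact (n + 1)\<close>\<close>
  define G where "G m t = \<sigma> * dd m t + c * t ^ (Suc n - m) / fact (Suc n - m)" for m t
  have dG: "\<forall>m t. m < n \<and> 0 \<le> t \<and> t \<le> 1 \<longrightarrow> DERIV (G m) t :> G (Suc m) t"
  proof (intro allI impI)
    fix m :: nat and t :: real assume a: "m < n \<and> 0 \<le> t \<and> t \<le> 1"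
    have k: "Suc n - m - 1 = Suc n - Suc m" by simp
    have "DERIV (G m) t :> \<sigma> * dd (Suc m) t + c * t ^ (Suc n - m - 1) / fact (Suc n - m - 1)"
    proof -
      have d1: "DERIV (\<lambda>z. \<sigma> * dd m z) t :> \<sigma> * dd (Suc m) t"
        using DERIV_cmult[OF der[of m t]] a by auto
      have d2: "DERIV (\<lambda>z. c * z ^ (Suc n - m) / fact (Suc n - m)) t :> c * t ^ (Suc n - m - 1) / fact (Suc n - m - 1)"
        using has_real_derivative_power_div_fact[of "Suc n - m" c t] a by simp
      show ?thesis unfolding G_def using DERIV_add[OF d1 d2] by simp
    qed
    then show "DERIV (G m) t :> G (Suc m) t" unfolding G_def k .
  qed
  obtain t where t: "0 < t" "t < 1"
    and eq: "G 0 1 = (\<Sum>m<n. (G m 0 / fact m) * (1 - 0)^m) + (G n t / fact n) * (1 - 0)^n"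
    using Taylor[OF n refl dG, of 0 1] by auto
  have G0: "G m 0 = \<sigma> * dd m 0" if "m < n" for m unfolding G_def using that by simp
  have Gn: "G n t \<ge> \<sigma> * dd n 0"
  proof -
    have "\<bar>dd n t - dd n 0\<bar> \<le> c * t" using rem t by simp
    then have "\<sigma> * dd n t + c * t \<ge> \<sigma> * dd n 0" using sg by (auto simp: abs_le_iff)
    then show ?thesis unfolding G_def by simp
  qed
  have "G 0 1 = \<sigma> * dd 0 1 + c / fact (Suc n)" unfolding G_def by simp
  moreover have "(\<Sum>m<n. (G m 0 / fact m) * (1 - 0)^m) = \<sigma> * (\<Sum>m<n. dd m 0 / fact m)"
    by (simp add: G0 sum_distrib_left)
  moreover have "G n t / fact n \<ge> \<sigma> * dd n 0 / fact n"
    using Gn by (simp add: divide_right_mono)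
  moreover have "(\<Sum>m\<le>n. dd m 0 / fact m) = (\<Sum>m<n. dd m 0 / fact m) + dd n 0 / fact n"
    by (simp add: lessThan_Suc_atMost[symmetric])
  ultimately show ?thesis using eq by (simp add: distrib_left)
qed

lemma taylor_remainder_bound:
  fixes dd :: "nat \<Rightarrow> real \<Rightarrow> real"
  assumes n: "0 < n"
    and der: "\<And>m t. m < n \<Longrightarrow> 0 \<le> t \<Longrightarrow> t \<le> 1 \<Longrightarrow> (dd m has_real_derivative dd (Suc m) t) (at t)"
    and rem: "\<And>t. 0 \<le> t \<Longrightarrow> t \<le> 1 \<Longrightarrow> \<bar>dd n t - dd n 0\<bar> \<le> c * t"
  shows "\<bar>dd 0 1 - (\<Sum>m\<le>n. dd m 0 / fact m)\<bar> \<le> c / fact (Suc n)"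
  using taylor_remainder_signed_bound[OF n _ der rem, of 1] taylor_remainder_signed_bound[OF n _ der rem, of "-1"]
  by (simp add: abs_le_iff)

lemma sym_multilinear_diff:
  assumes "sym_multilinear n A" "sym_multilinear n A'"
  shows "sym_multilinear n (\<lambda>hs. A hs - A' hs)"
  unfolding sym_multilinear_def
proof (intro conjI allI impI)
  fix xs ys :: "'a list" assume "length xs = n" "mset xs = mset ys"
  then show "A xs - A' xs = A ys - A' ys" using assms by (simp add: sym_multilinear_perm)
next
  fix t :: "'a list" assume "0 < n" "length t = n - 1"
  then have l: "linear (\<lambda>v. A (v # t))" "linear (\<lambda>v. A' (v # t))"
    using assms by (simp_all add: sym_multilinear_linear)
  show "linear (\<lambda>v. A (v # t) - A' (v # t))"
    by (intro linearI) (simp_all add: linear_add[OF l(1)] linear_cmul[OF l(1)]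
        linear_add[OF l(2)] linear_cmul[OF l(2)] algebra_simps)
qed

lemma derivs_upto_sym_multilinear:
  assumes fD: "derivs_upto p f D U" and U: "open U" and y: "y \<in> U"
  shows "sym_multilinear p (D p y)"
  unfolding sym_multilinear_def
proof (intro conjI allI impI)
  fix xs ys :: "'a list" assume "length xs = p" "mset xs = mset ys"
  then show "D p y xs = D p y ys" using derivs_upto_perm[OF fD U _ y] by simp
next
  fix t :: "'a list" assume "0 < p" "length t = p - 1"
  then show "linear (\<lambda>v. D p y (v # t))"
    using derivs_upto_linear[OF fD _ y, of "p - 1" t] by simp
qed

lemma derivs_upto_along_line:
  fixes D :: "nat \<Rightarrow> 'a::euclidean_space \<Rightarrow> 'a list \<Rightarrow> real"
  assumes fD: "derivs_upto p f D U" and U: "open U" and m: "Suc m < p" and z: "x + \<tau> *\<^sub>R r \<in> U"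
  shows "((\<lambda>\<tau>. D (Suc m) (x + \<tau> *\<^sub>R r) (u # replicate m r)) has_real_derivative
      D (Suc (Suc m)) (x + \<tau> *\<^sub>R r) (u # replicate (Suc m) r)) (at \<tau>)"
proof -
  have "((\<lambda>\<tau>. D (Suc m) (x + \<tau> *\<^sub>R r) (u # replicate m r)) has_real_derivative
      D (Suc (Suc m)) (x + \<tau> *\<^sub>R r) (r # u # replicate m r)) (at \<tau>)"
    using derivs_upto_has_derivative[OF fD m z, of "u # replicate m r"]
    by (intro has_real_derivative_along_line) simp
  moreover have "D (Suc (Suc m)) (x + \<tau> *\<^sub>R r) (r # u # replicate m r)
      = D (Suc (Suc m)) (x + \<tau> *\<^sub>R r) (u # replicate (Suc m) r)"
    using derivs_upto_perm[OF fD U _ z, where hs = "r # u # replicate m r" and hs' = "u # replicate (Suc m) r"] m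
    by (simp add: add_mset_commute)
  ultimately show ?thesis by simp
qed

lemma taylor_grad_inner:
  fixes D :: "nat \<Rightarrow> 'a::euclidean_space \<Rightarrow> 'a list \<Rightarrow> real"
  assumes fD: "derivs_upto p f D U" and x: "x \<in> U"
  shows "inner (taylor_grad p D x T) u = (\<Sum>k=1..p. D k x (u # replicate (k - 1) (T - x)) / fact (k - 1))"
  unfolding taylor_grad_def
proof (rule dual_vec_inner, rule linear_compose_sum, intro ballI)
  fix k assume k: "k \<in> {1..p}"
  then have l: "linear (\<lambda>u. D k x (u # replicate (k - 1) (T - x)))"
    using derivs_upto_linear[OF fD _ x, of "k - 1" "replicate (k - 1) (T - x)"] by auto
  show "linear (\<lambda>u. D k x (u # replicate (k - 1) (T - x)) / fact (k - 1))"
    using linear_compose[OF l bounded_linear.linear[OF bounded_linear_divide]] by (simp add: o_def)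
qed

lemma derivs_upto_top_increment_bound:
  fixes B :: "'a::euclidean_space \<Rightarrow> 'a" and D :: "nat \<Rightarrow> 'a \<Rightarrow> 'a list \<Rightarrow> real"
  assumes B: "self_adjoint_pd B" and fD: "derivs_upto p f D U" and U: "open U" and p: "0 < p"
    and E: "E \<subseteq> U" "x \<in> E" "y \<in> E"
    and Lip: "\<forall>y\<in>E. \<forall>z\<in>E. form_norm B p (\<lambda>hs. D p y hs - D p z hs) \<le> L * Bnorm B (y - z)"
  shows "\<bar>D p y (u # replicate (p - 1) r) - D p x (u # replicate (p - 1) r)\<bar>
           \<le> L * Bnorm B (y - x) * Bnorm B u * Bnorm B r ^ (p - 1)"
proof -
  define A where "A hs = D p y hs - D p x hs" for hs
  have "sym_multilinear p A" unfolding A_def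
    using E by (intro sym_multilinear_diff derivs_upto_sym_multilinear[OF fD U]) auto
  then have "\<bar>A (u # replicate (p - 1) r)\<bar> \<le> form_norm B p A * Bnorm B u * Bnorm B r ^ (p - 1)"
    using form_norm_mixed_bound[OF B _ p] by blast
  also have "\<dots> \<le> L * Bnorm B (y - x) * Bnorm B u * Bnorm B r ^ (p - 1)"
    using Lip E(2,3) Bnorm_nonneg[OF B, of u] Bnorm_nonneg[OF B, of r]
    unfolding A_def by (intro mult_right_mono) auto
  finally show ?thesis unfolding A_def .
qed

lemma taylor_grad_error_bound:
  fixes B :: "'a::euclidean_space \<Rightarrow> 'a" and D :: "nat \<Rightarrow> 'a \<Rightarrow> 'a list \<Rightarrow> real"
  assumes B: "self_adjoint_pd B" and fD: "derivs_upto p f D U" and U: "open U" and p: "2 \<le> p"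
    and E: "E \<subseteq> U" and seg: "\<And>\<tau>. 0 \<le> \<tau> \<Longrightarrow> \<tau> \<le> 1 \<Longrightarrow> x + \<tau> *\<^sub>R (T - x) \<in> E"
    and Lip: "\<forall>y\<in>E. \<forall>z\<in>E. form_norm B p (\<lambda>hs. D p y hs - D p z hs) \<le> L * Bnorm B (y - z)"
  shows "\<bar>inner (dual_vec (\<lambda>u. D 1 T [u]) - taylor_grad p D x T) u\<bar>
           \<le> L / fact p * Bnorm B (T - x) ^ p * Bnorm B u"
proof -
  define r where "r = T - x"
  define n where "n = p - 1"
  have x: "x \<in> E" "x \<in> U" and T: "T \<in> U" using seg[of 0] seg[of 1] E by auto
  have n: "0 < n" "p = Suc n" unfolding n_def using p by auto
  define dd where "dd m \<tau> = D (Suc m) (x + \<tau> *\<^sub>R r) (u # replicate m r)" for m \<tau>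
  have der: "(dd m has_real_derivative dd (Suc m) \<tau>) (at \<tau>)" if "m < n" "0 \<le> \<tau>" "\<tau> \<le> 1" for m \<tau>
    unfolding dd_def using derivs_upto_along_line[OF fD U] seg[OF that(2,3)] E that(1) n
    unfolding r_def by auto
  define c where "c = L * Bnorm B r ^ p * Bnorm B u"
  have rem: "\<bar>dd n t - dd n 0\<bar> \<le> c * t" if t: "0 \<le> t" "t \<le> 1" for t
  proof -
    have "\<bar>dd n t - dd n 0\<bar> \<le> L * Bnorm B (t *\<^sub>R r) * Bnorm B u * Bnorm B r ^ (p - 1)"
      using derivs_upto_top_increment_bound[OF B fD U _ E x(1) seg[OF t] Lip] n
      unfolding dd_def r_def by simp
    also have "\<dots> = c * t" unfolding c_def using t n by (simp add: Bnorm_scaleR[OF B] algebra_simps)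
    finally show ?thesis .
  qed
  have "inner (dual_vec (\<lambda>u. D 1 T [u]) - taylor_grad p D x T) u = dd 0 1 - (\<Sum>m\<le>n. dd m 0 / fact m)"
  proof -
    have "inner (dual_vec (\<lambda>u. D 1 T [u])) u = dd 0 1"
      using dual_vec_inner[OF derivs_upto_linear[OF fD _ T, of 0 "[]"]] p unfolding dd_def r_def by simp
    moreover have "(\<Sum>k=1..p. D k x (u # replicate (k - 1) (T - x)) / fact (k - 1)) = (\<Sum>m\<le>n. dd m 0 / fact m)"
      unfolding n(2) dd_def r_def atMost_atLeast0
      using sum.shift_bounds_cl_Suc_ivl[of "\<lambda>k. D k x (u # replicate (k - 1) (T - x)) / fact (k - 1)" 0 n]
      by simp
    ultimately show ?thesis using taylor_grad_inner[OF fD x(2), of T u] by (simp add: inner_diff_left)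
  qed
  also have "\<bar>dd 0 1 - (\<Sum>m\<le>n. dd m 0 / fact m)\<bar> \<le> c / fact (Suc n)"
    by (rule taylor_remainder_bound[OF n(1) der rem])
  finally show ?thesis unfolding c_def r_def n(2)[symmetric] by simp
qed

section \<open>The regularized Taylor step\<close>

lemma regularized_step_young_eq:
  fixes P L \<beta> a \<rho> fp :: real
  assumes P: "P \<ge> 2" and L: "L > 0" and \<beta>: "\<beta> > 1" and a: "a > 0" and \<rho>: "\<rho> > 0" and fp: "fp > 0"
  defines "\<theta> \<equiv> (P + 1) / (2 * P)" and "q \<equiv> (P - 1) / (2 * P)"
    and "Y \<equiv> (\<beta>\<^sup>2 - 1) * L\<^sup>2 * \<rho> powr (2 * P) / fp\<^sup>2" and "Den \<equiv> 2 * \<beta> * L * \<rho> powr (P - 1) / fp"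
  shows "(a\<^sup>2 / \<theta>) powr \<theta> * (Y / q) powr q / Den
    = (fp / ((P + 1) * L)) powr (1 / P) * a powr ((P + 1) / P) * ((\<beta>\<^sup>2 - 1) powr q / \<beta>) * (P / (P\<^sup>2 - 1) powr q)"
    (is "?l = ?r")
proof -
  have P1: "P\<^sup>2 - 1 > 0" "P - 1 > 0" "P + 1 > 0" "P > 0" "P\<^sup>2 - 1 = (P - 1) * (P + 1)"
    using P by (auto simp: power2_eq_square algebra_simps) (smt (verit) mult_le_cancel_right1)
  have b2: "\<beta>\<^sup>2 - 1 > 0" using \<beta> by (smt (verit) one_less_power pos2)
  have pos: "\<theta> > 0" "q > 0" "Y > 0" "Den > 0"
    unfolding \<theta>_def q_def Y_def Den_def using P1 b2 L \<rho> fp \<beta> by auto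
  have "?l > 0" using pos a by simp
  moreover have "?r > 0"
  proof -
    have "(fp / ((P + 1) * L)) powr (1 / P) > 0" "a powr ((P + 1) / P) > 0"
      "(\<beta>\<^sup>2 - 1) powr q > 0" "(P\<^sup>2 - 1) powr q > 0"
      using fp P1(1,3) L a b2 by (simp_all del: diff_gt_0_iff_gt)
    then show ?thesis using \<beta> P1(4) by (intro mult_pos_pos divide_pos_pos) auto
  qed
  moreover have "ln ?l = ln ?r"
  proof -
    have l1: "ln ?l = \<theta> * (2 * ln a - ln \<theta>) + q * (ln Y - ln q) - ln Den"
      using pos a by (simp add: ln_div ln_mult ln_powr power2_eq_square)
    have l2: "ln Y = ln (\<beta>\<^sup>2 - 1) + 2 * ln L + 2 * P * ln \<rho> - 2 * ln fp"
      unfolding Y_def using b2 L \<rho> fp by (simp add: ln_div ln_mult ln_powr power2_eq_square)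
    have l3: "ln Den = ln 2 + ln \<beta> + ln L + (P - 1) * ln \<rho> - ln fp"
      unfolding Den_def using \<beta> L \<rho> fp by (simp add: ln_div ln_mult ln_powr)
    have l4: "ln \<theta> = ln (P + 1) - ln 2 - ln P" "ln q = ln (P - 1) - ln 2 - ln P"
      unfolding \<theta>_def q_def using P1 by (simp_all add: ln_div ln_mult)
    have l5: "ln ?r = (1 / P) * (ln fp - ln (P + 1) - ln L) + ((P + 1) / P) * ln a
        + q * ln (\<beta>\<^sup>2 - 1) - ln \<beta> + ln P - q * (ln (P - 1) + ln (P + 1))"
      using fp P1 L a \<beta> pos(2) b2[THEN less_imp_neq, symmetric] by (simp add: ln_div ln_mult ln_powr)
    show ?thesis unfolding l1 l2 l3 l4 l5 unfolding \<theta>_def q_def using P1 by (simp add: field_simps)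
  qed
  ultimately show ?thesis by (simp add: ln_inj_iff)
qed

lemma regularized_step_young_bound:
  fixes P L \<beta> a \<rho> X fp :: real
  assumes P: "P \<ge> 2" and L: "L > 0" and \<beta>: "\<beta> > 1" and a: "a > 0" and \<rho>: "\<rho> > 0" and fp: "fp > 0"
    and hyp: "a\<^sup>2 + (\<beta>\<^sup>2 - 1) * L\<^sup>2 * \<rho> powr (2 * P) / fp\<^sup>2 \<le> X * (2 * \<beta> * L * \<rho> powr (P - 1) / fp)"
  shows "X \<ge> (fp / ((P + 1) * L)) powr (1 / P) * a powr ((P + 1) / P)
             * ((\<beta>\<^sup>2 - 1) powr ((P - 1) / (2 * P)) / \<beta>) * (P / (P\<^sup>2 - 1) powr ((P - 1) / (2 * P)))"
proof -
  define \<theta> where "\<theta> = (P + 1) / (2 * P)"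
  define q where "q = (P - 1) / (2 * P)"
  define Y where "Y = (\<beta>\<^sup>2 - 1) * L\<^sup>2 * \<rho> powr (2 * P) / fp\<^sup>2"
  define Den where "Den = 2 * \<beta> * L * \<rho> powr (P - 1) / fp"
  have "\<theta> > 0" "q > 0" "\<theta> + q = 1" unfolding \<theta>_def q_def using P by (auto simp: field_simps)
  moreover have "Y > 0" unfolding Y_def using \<beta> L \<rho> fp by (simp add: power_less_one_iff abs_if)
  ultimately have "(a\<^sup>2 / \<theta>) powr \<theta> * (Y / q) powr q \<le> a\<^sup>2 + Y"
    using Youngs_inequality_0[of \<theta> q "a\<^sup>2 / \<theta>" "Y / q"] a by simp
  also have "\<dots> \<le> X * Den" using hyp unfolding Y_def Den_def by simp
  finally have "(a\<^sup>2 / \<theta>) powr \<theta> * (Y / q) powr q \<le> X * Den" .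
  moreover have "Den > 0" unfolding Den_def using \<beta> L \<rho> fp by simp
  ultimately have "(a\<^sup>2 / \<theta>) powr \<theta> * (Y / q) powr q / Den \<le> X"
    by (simp add: pos_divide_le_eq)
  then show ?thesis
    using regularized_step_young_eq[OF P L \<beta> a \<rho> fp] unfolding \<theta>_def q_def Y_def Den_def by simp
qed


lemma regularized_step_young_bound_nat:
  fixes p :: nat and L \<beta> a \<rho> X :: real
  assumes p: "2 \<le> p" and L: "0 < L" and \<beta>: "1 < \<beta>" and a: "0 < a" and \<rho>: "0 < \<rho>"
    and hyp: "a\<^sup>2 + (\<beta>\<^sup>2 - 1) * (L / fact p * \<rho> ^ p)\<^sup>2 \<le> 2 * (\<beta> * L / fact p * \<rho> ^ (p - 1)) * X"
  shows "(fact p / ((p + 1) * L)) powr (1 / p) * a powr ((p + 1) / p)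
           * ((\<beta>\<^sup>2 - 1) powr ((p - 1) / (2 * p)) / \<beta>)
           * (p / ((real p)\<^sup>2 - 1) powr ((p - 1) / (2 * p))) \<le> X"
proof -
  have "\<rho> powr (2 * real p) = \<rho> ^ (p * 2)"
    using powr_realpow[OF \<rho>, of "p * 2"] by (simp add: mult.commute)
  then have pow1: "\<rho> powr (2 * real p) = (\<rho> ^ p)\<^sup>2" by (simp add: power_mult)
  have pow2: "\<rho> powr (real p - 1) = \<rho> ^ (p - 1)"
    using powr_realpow[OF \<rho>, of "p - 1"] p by (simp add: of_nat_diff)
  have "(L / fact p * \<rho> ^ p)\<^sup>2 = L\<^sup>2 * (\<rho> ^ p)\<^sup>2 / (fact p)\<^sup>2"
    by (simp add: power_mult_distrib power_divide)
  then have "a\<^sup>2 + (\<beta>\<^sup>2 - 1) * L\<^sup>2 * \<rho> powr (2 * real p) / (fact p)\<^sup>2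
      \<le> X * (2 * \<beta> * L * \<rho> powr (real p - 1) / fact p)"
    using hyp unfolding pow1 pow2 by (simp add: ac_simps)
  from regularized_step_young_bound[OF _ L \<beta> a \<rho> _ this]
  show ?thesis using p by (simp add: of_nat_diff add.commute)
qed

lemma regularized_step_scalar_bound:
  fixes p :: nat and L \<beta> a \<rho> X :: real
  assumes p: "2 \<le> p" and L: "0 < L" and \<beta>: "1 < \<beta>" and a: "0 \<le> a" and \<rho>: "0 \<le> \<rho>"
    and X: "\<rho> = 0 \<Longrightarrow> X = 0"
    and hyp0: "a\<^sup>2 + (\<beta> * L / fact p * \<rho> ^ (p - 1))\<^sup>2 * \<rho>\<^sup>2 - (L / fact p * \<rho> ^ p)\<^sup>2
      \<le> 2 * (\<beta> * L / fact p * \<rho> ^ (p - 1)) * X"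
  shows "X \<ge> (fact p / ((p + 1) * L)) powr (1 / p) * a powr ((p + 1) / p)
           * ((\<beta>\<^sup>2 - 1) powr ((p - 1) / (2 * p)) / \<beta>)
           * (p / ((real p)\<^sup>2 - 1) powr ((p - 1) / (2 * p)))
         \<and> (\<beta> = p \<longrightarrow> X \<ge> (fact p / ((p + 1) * L)) powr (1 / p) * a powr ((p + 1) / p))"
proof -
  have "\<rho> ^ (p - 1) * \<rho> = \<rho> ^ p" using p by (cases p) (simp_all add: mult.commute)
  then have "(\<beta> * L / fact p * \<rho> ^ (p - 1))\<^sup>2 * \<rho>\<^sup>2 = \<beta>\<^sup>2 * (L / fact p * \<rho> ^ p)\<^sup>2"
    by (simp flip: power_mult_distrib add: ac_simps)
  then have hyp: "a\<^sup>2 + (\<beta>\<^sup>2 - 1) * (L / fact p * \<rho> ^ p)\<^sup>2 \<le> 2 * (\<beta> * L / fact p * \<rho> ^ (p - 1)) * X"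
    using hyp0 by (simp add: algebra_simps)
  have bound: "(fact p / ((p + 1) * L)) powr (1 / p) * a powr ((p + 1) / p)
           * ((\<beta>\<^sup>2 - 1) powr ((p - 1) / (2 * p)) / \<beta>)
           * (p / ((real p)\<^sup>2 - 1) powr ((p - 1) / (2 * p))) \<le> X" (is "?c * ?f1 * ?f2 \<le> X")
  proof (cases "a = 0 \<or> \<rho> = 0")
    case True
    have "0 \<le> X"
    proof (cases "\<rho> = 0")
      case False
      define c where "c = 2 * (\<beta> * L / fact p * \<rho> ^ (p - 1))"
      have "0 \<le> (\<beta>\<^sup>2 - 1) * (L / fact p * \<rho> ^ p)\<^sup>2" using \<beta> by (simp add: abs_if)
      then have "0 \<le> c * X" using hyp True False unfolding c_def by simp
      moreover have "0 < c" unfolding c_def using \<beta> L \<rho> False by simp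
      ultimately show ?thesis by (simp add: zero_le_mult_iff)
    qed (use X in simp)
    moreover have "a = 0" using True hyp p \<beta> by (auto simp: power_0_left)
    ultimately show ?thesis using p by simp
  next
    case False
    then show ?thesis using regularized_step_young_bound_nat[OF p L \<beta> _ _ hyp] a \<rho> by simp
  qed
  have factor: "?f1 * ?f2 = 1" if "\<beta> = p"
  proof -
    have "1 < (real p)\<^sup>2" using one_less_power[of "real p" 2] \<beta> that by simp
    then have "((real p)\<^sup>2 - 1) powr ((p - 1) / (2 * p)) > 0" by simp
    then show ?thesis using that p by simp
  qed
  show ?thesis
  proof (intro conjI impI)
    show "?c * ?f1 * ?f2 \<le> X" by (rule bound)
    assume "\<beta> = p"
    from bound have "?c * (?f1 * ?f2) \<le> X" by (simp only: mult.assoc)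
    then show "?c \<le> X" unfolding factor[OF \<open>\<beta> = p\<close>] by simp
  qed
qed

lemma edom_convex:
  assumes h: "proper_fun h" "convex_fun h" and yz: "y \<in> edom h" "z \<in> edom h" and t: "0 \<le> t" "t \<le> 1"
  shows "(1 - t) *\<^sub>R y + t *\<^sub>R z \<in> edom h"
proof -
  have "h y < \<infinity>" "h z < \<infinity>" "h y > - \<infinity>" "h z > - \<infinity>"
    using yz h(1) unfolding edom_def proper_fun_def by auto
  then obtain a1 a2 where a: "h y = ereal a1" "h z = ereal a2"
    by (cases "h y"; cases "h z") auto
  have "h ((1 - t) *\<^sub>R y + t *\<^sub>R z) \<le> ereal (1 - t) * h y + ereal t * h z"
    using h(2) t unfolding convex_fun_def by blast
  also have "\<dots> = ereal ((1 - t) * a1 + t * a2)" using a by simp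
  finally show ?thesis unfolding edom_def by (auto simp: top.not_eq_extremum)
qed

lemma edom_minimizer:
  assumes h: "proper_fun h" and x: "x \<in> edom h"
    and T: "\<forall>y. ereal (\<phi> T) + h T \<le> ereal (\<phi> y) + h y"
  shows "T \<in> edom h"
proof -
  have "ereal (\<phi> x) + h x < \<infinity>"
    using x h unfolding edom_def proper_fun_def by (cases "h x") auto
  then show ?thesis using T[rule_format, of x] unfolding edom_def by auto
qed

theorem lemma1:
  fixes B :: "'a::euclidean_space \<Rightarrow> 'a"
    and f :: "'a \<Rightarrow> real" and h :: "'a \<Rightarrow> ereal"
    and D :: "nat \<Rightarrow> 'a \<Rightarrow> 'a list \<Rightarrow> real"
    and U :: "'a set" and p :: nat and L \<beta> H :: real and x T :: 'a
  assumes B: "self_adjoint_pd B"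
    and h: "proper_fun h" "closed_fun h" "convex_fun h"
    and U: "open U" "convex U" "edom h \<subseteq> U"
    and fconv: "convex_on U f"
    and fD: "derivs_upto p f D U"
    and L: "0 < L"
    and Lip: "\<forall>y\<in>edom h. \<forall>z\<in>edom h. form_norm B p (\<lambda>hs. D p y hs - D p z hs) \<le> L * Bnorm B (y - z)"
    and p: "2 \<le> p"
    and x: "x \<in> edom h"
    and \<beta>: "1 < \<beta>" and H: "H = \<beta> * L"
    and T: "\<forall>y. ereal (taylor p f D x T + H / fact (p + 1) * Bnorm B (T - x) ^ (p + 1)) + h T
               \<le> ereal (taylor p f D x y + H / fact (p + 1) * Bnorm B (y - x) ^ (p + 1)) + h y"
  defines "F' \<equiv> dual_vec (\<lambda>u. D 1 T [u]) - taylor_grad p D x T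
                  - (H / fact p * Bnorm B (T - x) ^ (p - 1)) *\<^sub>R B (T - x)"
  shows "inner F' (x - T) \<ge>
           (fact p / ((p + 1) * L)) powr (1 / p) * Bdnorm B F' powr ((p + 1) / p)
           * ((\<beta>\<^sup>2 - 1) powr ((p - 1) / (2 * p)) / \<beta>)
           * (p / ((real p)\<^sup>2 - 1) powr ((p - 1) / (2 * p)))
         \<and> (\<beta> = p \<longrightarrow> inner F' (x - T) \<ge>
           (fact p / ((p + 1) * L)) powr (1 / p) * Bdnorm B F' powr ((p + 1) / p))"
proof -
  define \<rho> where "\<rho> = Bnorm B (T - x)"
  define K where "K = L / fact p * \<rho> ^ p"
  have TE: "T \<in> edom h" by (rule edom_minimizer[OF h(1) x T])
  have "x + \<tau> *\<^sub>R (T - x) \<in> edom h" if "0 \<le> \<tau>" "\<tau> \<le> 1" for \<tau>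
    using edom_convex[OF h(1,3) x TE that] by (simp add: algebra_simps)
  from taylor_grad_error_bound[OF B fD U(1) p U(3) this Lip]
  have "\<bar>inner (dual_vec (\<lambda>u. D 1 T [u]) - taylor_grad p D x T) u\<bar> \<le> K * Bnorm B u" for u
    unfolding K_def \<rho>_def .
  moreover have "0 \<le> K" unfolding K_def \<rho>_def using L Bnorm_nonneg[OF B] by simp
  ultimately have hyp: "(Bdnorm B F')\<^sup>2 + (\<beta> * L / fact p * \<rho> ^ (p - 1))\<^sup>2 * \<rho>\<^sup>2
      - (L / fact p * \<rho> ^ p)\<^sup>2 \<le> 2 * (\<beta> * L / fact p * \<rho> ^ (p - 1)) * inner F' (x - T)"
    using shifted_gradient_inequality[OF B, where c = "H / fact p * \<rho> ^ (p - 1)" and r = "T - x"]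
    unfolding F'_def \<rho>_def K_def H[symmetric] by (simp only: minus_diff_eq)
  have "\<rho> = 0 \<Longrightarrow> inner F' (x - T) = 0" unfolding \<rho>_def using Bnorm_eq_0[OF B] by simp
  moreover have "0 \<le> Bdnorm B F'" "0 \<le> \<rho>"
    unfolding \<rho>_def Bdnorm_eq_Bnorm_inv[OF B] by (simp_all add: Bnorm_nonneg[OF B])
  ultimately show ?thesis by (intro regularized_step_scalar_bound[OF p L \<beta> _ _ _ hyp])
qed

end
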